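(* Let $T$ be a $(c,r)$-Ruelle expansive, topologically mixing map of a compact metric space $(\Omega,d)$ of diameter $1$ and let $a:\Omega\to\mathbb{R}$ be such that either setting (I) or setting (II) of the context holds, with associated $\omega$, $\gamma>0$ and $\omega^\dagger$. Then there exist a constant $\kappa$ depending only on $T$ and $\gamma$ and a constant $c_a$ depending continuously on $\|a\|_\omega$ such that for every $\omega^\dagger$-Hölder continuous $f:\Omega\to\mathbb{R}$ and every $n\in\mathbb{N}$, $$\left\|\frac{\mathcal{L}_a^n(f)}{\mathcal{L}_a^n(\mathbf 1)}-m_a(f)\right\|_\infty\le\kappa\,e^{\kappa C_a}\,\|f\|_{\omega^\dagger}\,(c_a+n)^{-\gamma},$$ where $C_a$ is the $\omega$-Hölder coefficient of $a$.
   Context: $\mathbb{N}=\{1,2,\dots\}$; $A\ll B$ means $A\le CB$ for a constant $C$ independent of $n,t$. Ruelle expansive: let $r>0$ and let $c_n:[0,1]\to[0,\infty)$ be functions with $c_n(0)=0$, $t\mapsto c_n(t)$ strictly increasing, $n\mapsto c_n(t)$ decreasing and $\lim_n c_n(t)=0$ for all $t$. $T:\Omega\to\Omega$ is $(c,r)$-Ruelle expansive if for all $n\in\mathbb{N}$ and $x,y,\tilde x\in\Omega$ with $d(x,y)<r$ and $T^n(\tilde x)=x$ there is a unique $\tilde y\in\Omega$ with $T^n(\tilde y)=y$ and $d(T^k\tilde x,T^k\tilde y)\le c_{n-k}(d(x,y))$ for $k=0,\dots,n$. Throughout, $T$ and its iterates are local homeomorphisms of $\Omega$. Topologically mixing: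 for all nonempty open $U,V\subset\Omega$ there is $k$ with $T^{-n}(U)\cap V\ne\emptyset$ for all $n>k$. For $\alpha,\beta\ge0$ (not both zero), $\omega_{\alpha,\beta\log}(t)=t^\alpha(\log t_0-\log t)^{-\beta}$, where $t_0>1$ is chosen such that this function is concave on $[0,1]$. $f$ is $\omega$-Hölder with coefficient $C_f$ if $|f(x)-f(y)|\le C_f\,\omega(d(x,y))$ for all $x,y\in\Omega$. $\|f\|_\omega=\|f\|_\infty+\mathrm{H\ddot{o}l}_\omega(f)$ with $\mathrm{H\ddot{o}l}_\omega(f)=\sup\{|f(x)-f(y)|/\omega(d(x,y)):0<d(x,y)<r\}$. Setting (I): $c_n(t)\ll s^nt$ for some $s\in(0,1)$ and $a$ is $\omega$-Hölder with $\omega=\omega_{0,\beta\log}$, $\beta>1$; $\gamma:=\beta-1$, $\omega^\dagger:=\omega_{0,(\beta-1)\log}$. Setting (II): $c_n(t)\ll t(1+nt^{1/\beta})^{-\beta}$ and $a$ is $\omega$-Hölder with $\omega=\omega_{\alpha,0\log}$, $\beta>1$, $\alpha\beta>1$; $\gamma:=\alpha\beta-1$, $\omega^\dagger:=\omega_{\alpha-1/\beta,0\log}$. $\mathcal{L}_a(f)(x)=\sum_{T(y)=x}e^{a(y)}f(y)$; $\rho_a=\lim_n(\mathcal{L}_a^n(\mathbf{1})(x))^{1/n}$ (independent of $x$). There is a strictly positive $\omega^\dagger$-Hölder function $h_a$ with $\mathcal{L}_a(h_a)=\rho_ah_a$. With $\overline a:=a+\log h_a-\log h_a\circ T-\log\rho_a$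 there is a unique Borel probability measure $\mu_a$ with $(\mathcal{L}_{\overline a})^\ast\mu_a=\mu_a$. Normalize $h_a$ so that $\mu_a(h_a^{-1})=1$ and let $dm_a:=h_a^{-1}d\mu_a$, a probability measure; $m_a(f)=\int f\,dm_a$. *)

theory Defs
  imports "HOL-Analysis.Analysis"
begin

text \<open>The space \<open>\<Omega>\<close> is the whole type \<open>'a\<close>, assumed compact where needed.\<close>

definition local_homeomorphism :: "('a::topological_space \<Rightarrow> 'b::topological_space) \<Rightarrow> bool" where
  "local_homeomorphism T \<longleftrightarrow>
     (\<forall>x. \<exists>U. open U \<and> x \<in> U \<and> open (T ` U) \<and> (\<exists>S. homeomorphism U (T ` U) T S))"

definition topologically_mixing :: "('a::topological_space \<Rightarrow> 'a) \<Rightarrow> bool" where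
  "topologically_mixing T \<longleftrightarrow>
     (\<forall>U V. open U \<and> U \<noteq> {} \<and> open V \<and> V \<noteq> {} \<longrightarrow>
        (\<exists>k. \<forall>n>k. ((T ^^ n) -` U) \<inter> V \<noteq> {}))"

text \<open>The index \<open>n\<close> starts at 0, because \<open>c\<^sub>0\<close> occurs in Ruelle expansivity (at \<open>k = n\<close>).
  The functions \<open>c n\<close> only matter on \<open>[0,1]\<close>.\<close>

definition contraction_family :: "(nat \<Rightarrow> real \<Rightarrow> real) \<Rightarrow> bool" where
  "contraction_family c \<longleftrightarrow>
     (\<forall>n. \<forall>t\<in>{0..1}. 0 \<le> c n t) \<and>
     (\<forall>n. c n 0 = 0) \<and>
     (\<forall>n. strict_mono_on {0..1} (c n)) \<and>
     (\<forall>t\<in>{0..1}. decseq (\<lambda>n. c n t)) \<and>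
     (\<forall>t\<in>{0..1}. (\<lambda>n. c n t) \<longlonglongrightarrow> 0)"

definition ruelle_expansive ::
    "(nat \<Rightarrow> real \<Rightarrow> real) \<Rightarrow> real \<Rightarrow> ('a::metric_space \<Rightarrow> 'a) \<Rightarrow> bool" where
  "ruelle_expansive c r T \<longleftrightarrow>
     (\<forall>n\<ge>1. \<forall>x y x'. dist x y < r \<and> (T ^^ n) x' = x \<longrightarrow>
        (\<exists>!y'. (T ^^ n) y' = y \<and>
               (\<forall>k\<le>n. dist ((T ^^ k) x') ((T ^^ k) y') \<le> c (n - k) (dist x y))))"

text \<open>The value at 0 is set explicitly: it is the limit at 0, whereas \<open>ln 0 = 0\<close> would give a
  nonzero value when \<open>\<alpha> = 0\<close>.\<close>

definition omega :: "real \<Rightarrow> real \<Rightarrow> real \<Rightarrow> real \<Rightarrow> real" where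
  "omega \<alpha> \<beta> t0 t = (if t = 0 then 0 else t powr \<alpha> * (ln t0 - ln t) powr (- \<beta>))"

text \<open>\<open>is_modulus \<alpha> \<beta> w\<close>: \<open>w\<close> is \<open>\<omega>\<close> with exponents \<open>\<alpha>\<close> and \<open>\<beta> log\<close>, for some admissible
  choice of \<open>t\<^sub>0\<close>.\<close>

definition is_modulus :: "real \<Rightarrow> real \<Rightarrow> (real \<Rightarrow> real) \<Rightarrow> bool" where
  "is_modulus \<alpha> \<beta> w \<longleftrightarrow> 0 \<le> \<alpha> \<and> 0 \<le> \<beta> \<and> (\<alpha>, \<beta>) \<noteq> (0, 0) \<and>
     (\<exists>t0>1. w = omega \<alpha> \<beta> t0 \<and> concave_on {0..1} (omega \<alpha> \<beta> t0))"

definition holder_with :: "(real \<Rightarrow> real) \<Rightarrow> real \<Rightarrow> ('a::metric_space \<Rightarrow> real) \<Rightarrow> bool" where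
  "holder_with w C f \<longleftrightarrow> (\<forall>x y. \<bar>f x - f y\<bar> \<le> C * w (dist x y))"

definition sup_norm :: "('a \<Rightarrow> real) \<Rightarrow> real" where
  "sup_norm f = (SUP x. \<bar>f x\<bar>)"

text \<open>Inserting 0 gives the supremum of the empty set its value in \<open>[0,\<infinity>]\<close>, and changes nothing
  otherwise.\<close>

definition hol_const :: "real \<Rightarrow> (real \<Rightarrow> real) \<Rightarrow> ('a::metric_space \<Rightarrow> real) \<Rightarrow> real" where
  "hol_const r w f =
     Sup (insert 0 {\<bar>f x - f y\<bar> / w (dist x y) | x y. 0 < dist x y \<and> dist x y < r})"

definition holder_norm :: "real \<Rightarrow> (real \<Rightarrow> real) \<Rightarrow> ('a::metric_space \<Rightarrow> real) \<Rightarrow> real" where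
  "holder_norm r w f = sup_norm f + hol_const r w f"

definition setting_I ::
    "(nat \<Rightarrow> real \<Rightarrow> real) \<Rightarrow> (real \<Rightarrow> real) \<Rightarrow> real \<Rightarrow> (real \<Rightarrow> real) \<Rightarrow> bool" where
  "setting_I c w \<gamma> wd \<longleftrightarrow>
     (\<exists>\<beta>>1. (\<exists>s\<in>{0<..<1}. \<exists>C. \<forall>n. \<forall>t\<in>{0..1}. c n t \<le> C * (s ^ n * t)) \<and>
        is_modulus 0 \<beta> w \<and> \<gamma> = \<beta> - 1 \<and> is_modulus 0 (\<beta> - 1) wd)"

definition setting_II ::
    "(nat \<Rightarrow> real \<Rightarrow> real) \<Rightarrow> (real \<Rightarrow> real) \<Rightarrow> real \<Rightarrow> (real \<Rightarrow> real) \<Rightarrow> bool" where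
  "setting_II c w \<gamma> wd \<longleftrightarrow>
     (\<exists>\<alpha> \<beta>. \<beta> > 1 \<and> \<alpha> * \<beta> > 1 \<and>
        (\<exists>C. \<forall>n. \<forall>t\<in>{0..1}.
            c n t \<le> C * (t * (1 + real n * t powr (1 / \<beta>)) powr (- \<beta>))) \<and>
        is_modulus \<alpha> 0 w \<and> \<gamma> = \<alpha> * \<beta> - 1 \<and> is_modulus (\<alpha> - 1 / \<beta>) 0 wd)"

text \<open>Fibres are finite when \<open>T\<close> is a local homeomorphism of a compact space.\<close>

definition transfer_op ::
    "('a \<Rightarrow> 'a) \<Rightarrow> ('a \<Rightarrow> real) \<Rightarrow> ('a \<Rightarrow> real) \<Rightarrow> 'a \<Rightarrow> real" where
  "transfer_op T a f x = (\<Sum>y | T y = x. exp (a y) * f y)"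

definition normalized_potential ::
    "('a \<Rightarrow> 'a) \<Rightarrow> ('a \<Rightarrow> real) \<Rightarrow> real \<Rightarrow> ('a \<Rightarrow> real) \<Rightarrow> 'a \<Rightarrow> real" where
  "normalized_potential T a \<rho> h x = a x + ln (h x) - ln (h (T x)) - ln \<rho>"

text \<open>\<open>rpf_data T a wd \<rho> h \<mu>\<close>: \<open>\<rho>\<close>, \<open>h\<close>, \<open>\<mu>\<close> are \<open>\<rho>\<^sub>a\<close>, the normalized \<open>h\<^sub>a\<close>, and \<open>\<mu>\<^sub>a\<close>.
  The identity \<open>L\<^sup>* \<mu> = \<mu>\<close> for the dual operator is tested on continuous functions.\<close>

definition rpf_data ::
    "('a::metric_space \<Rightarrow> 'a) \<Rightarrow> ('a \<Rightarrow> real) \<Rightarrow> (real \<Rightarrow> real) \<Rightarrow>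
     real \<Rightarrow> ('a \<Rightarrow> real) \<Rightarrow> 'a measure \<Rightarrow> bool" where
  "rpf_data T a wd \<rho> h \<mu> \<longleftrightarrow>
     (\<forall>x. (\<lambda>n. root n ((transfer_op T a ^^ n) (\<lambda>_. 1) x)) \<longlonglongrightarrow> \<rho>) \<and>
     (\<forall>x. 0 < h x) \<and> (\<exists>C. holder_with wd C h) \<and>
     (\<forall>x. transfer_op T a h x = \<rho> * h x) \<and>
     sets \<mu> = sets borel \<and> emeasure \<mu> UNIV = 1 \<and>
     (\<forall>f. continuous_on UNIV f \<longrightarrow>
        (\<integral>x. transfer_op T (normalized_potential T a \<rho> h) f x \<partial>\<mu>) = (\<integral>x. f x \<partial>\<mu>)) \<and>
     (\<integral>x. inverse (h x) \<partial>\<mu>) = 1"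

definition conformal_measure :: "('a \<Rightarrow> real) \<Rightarrow> 'a measure \<Rightarrow> 'a measure" where
  "conformal_measure h \<mu> = density \<mu> (\<lambda>x. ennreal (inverse (h x)))"

end

theory Submission
  imports Defs
begin

text \<open>Put \<open>Q\<^sub>n f = L\<^sub>a\<^sup>n f / L\<^sub>a\<^sup>n 1\<close>. Since \<open>m\<^sub>a\<close> is conformal, \<open>m\<^sub>a(f)\<close> is a weighted average of
  \<open>Q\<^sub>n f\<close>, so it suffices to bound the oscillation of \<open>Q\<^sub>n f\<close>; no estimate on \<open>h\<^sub>a\<close> is needed.
  \<open>Q\<^bsub>N+m+l\<^esub> f\<close> is an average of \<open>Q\<^sub>l f\<close> over preimages. By mixing, any two points have
  close preimages of order \<open>N\<close>, and expansivity pairs the preimages of order \<open>m\<close> of two close points.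
  Bounded distortion makes the weights of paired preimages comparable, and \<open>Q\<^sub>l f\<close> varies by
  \<open>O(m powr - \<gamma>)\<close> over a pair, because both \<open>\<Sum>j>m. \<omega>(c\<^sub>j)\<close> and \<open>\<omega>\<^sup>\<dagger>(c\<^sub>m)\<close> do. Hence
  \<open>osc Q\<^bsub>N+m+l\<^esub> f \<le> (1 - \<epsilon>) osc Q\<^sub>l f + K m powr - \<gamma>\<close> with \<open>1/\<epsilon>\<close> and \<open>K\<close> exponentially bounded
  in \<open>C\<^sub>a\<close>. Iterating with \<open>m\<close> proportional to \<open>n\<close> gives the rate \<open>n powr - \<gamma>\<close>. The constant
  \<open>c\<^sub>a = 1\<close> is good enough.\<close>

section \<open>Birkhoff sums, averages and power sums\<close>

definition birkhoff_sum :: "('a \<Rightarrow> 'a) \<Rightarrow> ('a \<Rightarrow> real) \<Rightarrow> nat \<Rightarrow> 'a \<Rightarrow> real" where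
  "birkhoff_sum T a n y = (\<Sum>k<n. a ((T ^^ k) y))"

lemma birkhoff_sum_0 [simp]: "birkhoff_sum T a 0 y = 0"
  by (simp add: birkhoff_sum_def)

lemma birkhoff_sum_Suc: "birkhoff_sum T a (Suc n) y = birkhoff_sum T a n y + a ((T ^^ n) y)"
  by (simp add: birkhoff_sum_def)

lemma fibre_Suc:
  fixes T :: "'a \<Rightarrow> 'a"
  shows "{y. (T ^^ Suc n) y = x} = (\<Union>z\<in>{z. T z = x}. {y. (T ^^ n) y = z})"
  by auto

lemma finite_fibre_iterate:
  fixes T :: "'a \<Rightarrow> 'a"
  assumes "\<And>x. finite {y. T y = x}"
  shows "finite {y. (T ^^ n) y = x}"
proof (induction n arbitrary: x)
  case (Suc n)
  show ?case unfolding fibre_Suc using assms Suc by blast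
qed simp

lemma card_fibre_iterate_le:
  fixes T :: "'a \<Rightarrow> 'a" and D :: nat
  assumes "\<And>x. finite {y. T y = x}" "\<And>x. card {y. T y = x} \<le> D"
  shows "card {y. (T ^^ n) y = x} \<le> D ^ n"
proof (induction n arbitrary: x)
  case (Suc n)
  have "card {y. (T ^^ Suc n) y = x} \<le> (\<Sum>z | T z = x. card {y. (T ^^ n) y = z})"
    unfolding fibre_Suc by (rule card_UN_le) (rule assms)
  also have "\<dots> \<le> card {z. T z = x} * D ^ n"
    using sum_bounded_above[of "{z. T z = x}" _ "D ^ n"] Suc by fastforce
  also have "\<dots> \<le> D ^ Suc n" using assms(2) by simp
  finally show ?case .
qed simp

text \<open>The fibre of order \<open>n + 1\<close> is split by the value of
  \<open>(T ^^ n) y\<close>. The outer application of the operator then contributes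
  \<open>a ((T ^^ n) y)\<close>, the last term of the Birkhoff sum.\<close>

lemma transfer_op_iterate:
  assumes fin: "\<And>x. finite {y. T y = x}"
  shows "(transfer_op T a ^^ n) f x = (\<Sum>y | (T ^^ n) y = x. exp (birkhoff_sum T a n y) * f y)"
proof (induction n arbitrary: x)
  case (Suc n)
  have "(transfer_op T a ^^ Suc n) f x
      = (\<Sum>z | T z = x. \<Sum>y | (T ^^ n) y = z. exp (birkhoff_sum T a (Suc n) y) * f y)"
    by (simp add: transfer_op_def Suc sum_distrib_left birkhoff_sum_Suc exp_add mult_ac)
  also have "\<dots> = (\<Sum>y | (T ^^ Suc n) y = x. exp (birkhoff_sum T a (Suc n) y) * f y)"
    unfolding fibre_Suc
    by (subst sum.UNION_disjoint) (auto simp: fin finite_fibre_iterate)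
  finally show ?case .
qed simp

section \<open>Differences of weighted averages\<close>

lemma weighted_average_diff_le:
  fixes p p' F F' :: "'i \<Rightarrow> real"
  assumes I: "finite I" "I \<noteq> {}" and sums: "sum p I = 1" "sum p' I = 1" and q: "0 \<le> q" "q \<le> 1"
    and p: "\<And>i. i \<in> I \<Longrightarrow> 0 \<le> p i" and p': "\<And>i. i \<in> I \<Longrightarrow> q * p i \<le> p' i"
    and d: "\<And>i. i \<in> I \<Longrightarrow> F i - F' i \<le> d"
    and v: "\<And>i j. i \<in> I \<Longrightarrow> j \<in> I \<Longrightarrow> F i - F' j \<le> v"
  shows "(\<Sum>i\<in>I. p i * F i) - (\<Sum>i\<in>I. p' i * F' i) \<le> q * d + (1 - q) * v"
proof -
  define lo where "lo = Min (F' ` I)"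
  have lo: "lo \<le> F' i" if "i \<in> I" for i using that I by (simp add: lo_def)
  have "lo \<in> F' ` I" unfolding lo_def using I by (intro Min_in) auto
  then have hi: "F i \<le> lo + v" if "i \<in> I" for i using v[OF that] by force
  \<comment> \<open>A coupling in algebraic form: the part \<open>q * p\<close> of the mass is
    common to both weights and is compared index by index at cost \<open>d\<close>. The rest, of
    total mass \<open>1 - q\<close> on either side, costs at most \<open>v\<close>, because
    \<open>F\<close> lies below \<open>lo + v\<close> and \<open>F'\<close> above
    \<open>lo\<close>.\<close>
  have "(\<Sum>i\<in>I. p i * F i) - (\<Sum>i\<in>I. p' i * F' i)
    = (\<Sum>i\<in>I. q * (p i * (F i - F' i)) + (1 - q) * (p i * F i) - (p' i - q * p i) * F' i)"
    by (simp add: sum_subtractf[symmetric] algebra_simps)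
  also have "\<dots> \<le> (\<Sum>i\<in>I. q * (p i * d) + (1 - q) * (p i * (lo + v)) - (p' i - q * p i) * lo)"
    using p p' d hi lo q by (intro sum_mono add_mono diff_mono mult_left_mono) auto
  also have "\<dots> = q * (sum p I * d) + (1 - q) * (sum p I * (lo + v)) - (sum p' I - q * sum p I) * lo"
    by (simp add: sum.distrib sum_subtractf flip: sum_distrib_left sum_distrib_right)
  also have "\<dots> = q * d + (1 - q) * v" using sums by (simp add: algebra_simps)
  finally show ?thesis .
qed

text \<open>Normalising costs a second factor \<open>exp E\<close>, because the two totals are
  comparable as well; so the common share of the mass is \<open>exp (- 2 * E)\<close>.\<close>

lemma weighted_ratio_diff_le:
  fixes u u' F F' :: "'i \<Rightarrow> real"
  assumes I: "finite I" "I \<noteq> {}"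
    and u: "\<And>i. i \<in> I \<Longrightarrow> 0 < u i" "\<And>i. i \<in> I \<Longrightarrow> 0 < u' i"
    and E: "0 \<le> E" "\<And>i. i \<in> I \<Longrightarrow> u i \<le> exp E * u' i" "\<And>i. i \<in> I \<Longrightarrow> u' i \<le> exp E * u i"
    and d: "\<And>i. i \<in> I \<Longrightarrow> F i - F' i \<le> d"
    and v: "\<And>i j. i \<in> I \<Longrightarrow> j \<in> I \<Longrightarrow> F i - F' j \<le> v"
  shows "(\<Sum>i\<in>I. u i * F i) / sum u I - (\<Sum>i\<in>I. u' i * F' i) / sum u' I
    \<le> exp (- 2 * E) * d + (1 - exp (- 2 * E)) * v"
proof -
  have pos: "0 < sum u I" "0 < sum u' I" using I u by (auto intro!: sum_pos)
  have le: "sum u' I \<le> exp E * sum u I"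
    unfolding sum_distrib_left by (intro sum_mono E)
  have "(\<Sum>i\<in>I. (u i / sum u I) * F i) - (\<Sum>i\<in>I. (u' i / sum u' I) * F' i)
    \<le> exp (- 2 * E) * d + (1 - exp (- 2 * E)) * v"
  proof (rule weighted_average_diff_le[OF I])
    fix i assume i: "i \<in> I"
    have "u i * sum u' I \<le> (exp E * u' i) * (exp E * sum u I)"
      using le E(2)[OF i] u(2)[OF i] pos by (intro mult_mono) auto
    also have "\<dots> = exp (2 * E) * (u' i * sum u I)"
      by (simp add: exp_add[symmetric])
    finally show "exp (- 2 * E) * (u i / sum u I) \<le> u' i / sum u' I"
      using pos by (simp add: exp_minus field_simps)
  qed (use I u E d v pos in \<open>auto simp: sum_divide_distrib[symmetric] less_imp_le\<close>)
  then show ?thesis by (simp add: sum_divide_distrib)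
qed

text \<open>Here the averages live on different index sets and two atoms, each of mass at least
  \<eta>, are compared with each other. In \<open>osc_contraction\<close> these are the two close
  preimages supplied by mixing; the remaining mass is charged \<open>v\<close>.\<close>

lemma weighted_average_diff_le_of_atoms:
  fixes F :: "'i \<Rightarrow> real" and p :: "'i \<Rightarrow> real" and p' :: "'i \<Rightarrow> real"
  assumes fin: "finite I" "finite J" and sums: "sum p I = 1" "sum p' J = 1"
    and p: "\<And>i. i \<in> I \<Longrightarrow> 0 \<le> p i" "\<And>i. i \<in> J \<Longrightarrow> 0 \<le> p' i"
    and x: "x \<in> I" "\<eta> \<le> p x" and y: "y \<in> J" "\<eta> \<le> p' y"
    and v: "\<And>i j. i \<in> I \<Longrightarrow> j \<in> J \<Longrightarrow> F i - F j \<le> v"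
  shows "(\<Sum>i\<in>I. p i * F i) - (\<Sum>j\<in>J. p' j * F j) \<le> \<eta> * (F x - F y) + (1 - \<eta>) * v"
proof -
  define lo where "lo = Min (F ` J)"
  have lo: "lo \<le> F i" if "i \<in> J" for i using that fin by (simp add: lo_def)
  have "lo \<in> F ` J" unfolding lo_def using fin y by (intro Min_in) auto
  then have hi: "F i \<le> lo + v" if "i \<in> I" for i using v[OF that] by force
  \<comment> \<open>Each average is treated separately: its distance to the extreme value
    (\<open>lo + v\<close> above, \<open>lo\<close> below) is at least the contribution of the
    chosen atom. Adding the two inequalities gives the claim.\<close>
  have "\<eta> * (lo + v - F x) \<le> p x * (lo + v - F x)"
    using x hi by (intro mult_right_mono) auto
  also have "\<dots> \<le> (\<Sum>i\<in>I. p i * (lo + v - F i))"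
    using fin p hi x by (intro member_le_sum) auto
  also have "\<dots> = sum p I * (lo + v) - (\<Sum>i\<in>I. p i * F i)"
    by (simp add: right_diff_distrib sum_subtractf sum_distrib_right)
  finally have 1: "\<eta> * (lo + v - F x) \<le> (lo + v) - (\<Sum>i\<in>I. p i * F i)" by (simp add: sums)
  have "\<eta> * (F y - lo) \<le> p' y * (F y - lo)"
    using y lo by (intro mult_right_mono) auto
  also have "\<dots> \<le> (\<Sum>i\<in>J. p' i * (F i - lo))"
    using fin p lo y by (intro member_le_sum) auto
  also have "\<dots> = (\<Sum>i\<in>J. p' i * F i) - sum p' J * lo"
    by (simp add: right_diff_distrib sum_subtractf sum_distrib_right)
  finally have 2: "\<eta> * (F y - lo) \<le> (\<Sum>i\<in>J. p' i * F i) - lo" by (simp add: sums)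
  show ?thesis using 1 2 by (simp add: algebra_simps)
qed

section \<open>Power sums and polynomial decay\<close>

lemma powr_diff_ge:
  fixes x \<gamma> :: real
  assumes "0 < \<gamma>" "0 < x"
  shows "(x + 1) powr - (\<gamma> + 1) \<le> (x powr - \<gamma> - (x + 1) powr - \<gamma>) / \<gamma>"
proof -
  have der: "((\<lambda>u. u powr - \<gamma>) has_real_derivative (- \<gamma> * u powr (- \<gamma> - 1))) (at u)" if "x \<le> u" for u
    using assms that by (intro derivative_eq_intros | simp)+
  obtain z where z: "x < z" "z < x + 1"
    "(x + 1) powr - \<gamma> - x powr - \<gamma> = (x + 1 - x) * (- \<gamma> * z powr (- \<gamma> - 1))"
    using MVT2[of x "x + 1", OF _ der] by auto
  have "\<gamma> * (x + 1) powr - (\<gamma> + 1) \<le> \<gamma> * z powr (- \<gamma> - 1)"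
    using powr_mono2'[of "- \<gamma> - 1" z "x + 1"] z assms by (intro mult_left_mono) auto
  then have "(x + 1) powr - (\<gamma> + 1) * \<gamma> \<le> x powr - \<gamma> - (x + 1) powr - \<gamma>"
    using z(3) by (simp add: mult.commute)
  then show ?thesis using assms by (simp add: pos_le_divide_eq)
qed

text \<open>The indices run from \<open>m + l\<close> down to \<open>m + 1\<close>, the order in
  which they arise along an orbit. Each term is dominated by a difference of consecutive powers, so
  the sum telescopes; keeping the negative term lets the induction close.\<close>

lemma sum_powr_tail_le:
  fixes \<gamma> :: real
  assumes "0 < \<gamma>" "1 \<le> m"
  shows "(\<Sum>k<l. real (m + l - k) powr - (\<gamma> + 1)) \<le> (real m powr - \<gamma> - real (m + l) powr - \<gamma>) / \<gamma>"
proof (induction l)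
  case (Suc l)
  have "(\<Sum>k<Suc l. real (m + Suc l - k) powr - (\<gamma> + 1))
      = real (m + l + 1) powr - (\<gamma> + 1) + (\<Sum>k<l. real (m + l - k) powr - (\<gamma> + 1))"
    by (subst sum.lessThan_Suc_shift) simp
  also have "\<dots> \<le> (real (m + l) powr - \<gamma> - real (m + l + 1) powr - \<gamma>) / \<gamma>
      + (real m powr - \<gamma> - real (m + l) powr - \<gamma>) / \<gamma>"
    using powr_diff_ge[of \<gamma> "real (m + l)"] assms Suc by (intro add_mono) (auto simp: add_ac)
  finally show ?case by (simp add: diff_divide_distrib add_ac)
qed simp

lemma sum_powr_le:
  fixes \<gamma> :: real
  assumes "0 < \<gamma>"
  shows "(\<Sum>k<l. real (l - k) powr - (\<gamma> + 1)) \<le> 1 + 1 / \<gamma>"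
proof (cases l)
  case (Suc n)
  \<comment> \<open>The tail estimate needs \<open>1 \<le> m\<close>, so the last term, which equals
    1, is split off and \<open>m = 1\<close> is used for the others.\<close>
  have "(\<Sum>k<l. real (l - k) powr - (\<gamma> + 1)) = (\<Sum>k<n. real (1 + n - k) powr - (\<gamma> + 1)) + 1"
    by (simp add: Suc)
  also have "\<dots> \<le> (real 1 powr - \<gamma> - real (1 + n) powr - \<gamma>) / \<gamma> + 1"
    using sum_powr_tail_le[OF assms, of 1 n] by simp
  also have "\<dots> \<le> 1 + 1 / \<gamma>" using assms by (simp add: divide_right_mono diff_divide_distrib)
  finally show ?thesis .
qed (use assms in simp)

text \<open>The block length \<open>m\<close> is a small multiple \<open>\<delta> n\<close> of \<open>n\<close>, with \<open>\<delta>\<close> so small that the factor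
  \<open>1 - \<epsilon>\<close> beats the loss \<open>(1 - \<delta>) powr - \<gamma>\<close>.\<close>

lemma polynomial_decay_of_block_contraction:
  fixes osc :: "nat \<Rightarrow> real \<Rightarrow> bool" and N k :: nat
  assumes \<gamma>: "0 < \<gamma>" "\<gamma> \<le> real k" and \<epsilon>: "0 < \<epsilon>" "\<epsilon> \<le> 1" and nonneg: "0 \<le> v0" "0 \<le> K"
    and osc_mono: "\<And>n u v. osc n u \<Longrightarrow> u \<le> v \<Longrightarrow> osc n v"
    and osc0: "\<And>n. osc n v0"
    and step: "\<And>l m v. 1 \<le> m \<Longrightarrow> osc l v \<Longrightarrow>
      osc (N + m + l) ((1 - \<epsilon>) * v + K * real m powr - \<gamma>)"
    and n: "1 \<le> n"
  shows "osc n ((v0 + 2 * K / \<epsilon>) * (4 * real k * (real N + 1) / \<epsilon>) powr \<gamma> * real n powr - \<gamma>)"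
proof -
  \<comment> \<open>With this \<delta>, Bernoulli's inequality gives
    \<open>(1 - \<delta>) ^ k \<ge> 1 - \<epsilon> / 2\<close>. The integer \<open>k\<close> stands
    in for \<gamma> because that inequality is about integer exponents.\<close>
  define \<delta> where "\<delta> = \<epsilon> / (2 * k)"
  define A where "A = (v0 + 2 * K / \<epsilon>) * (4 * real k * (real N + 1) / \<epsilon>) powr \<gamma>"
  have k: "1 \<le> k" using \<gamma> by (cases k) auto
  then have \<delta>: "0 < \<delta>" "\<delta> \<le> 1 / 2" using \<epsilon> by (auto simp: \<delta>_def field_simps)
  have A: "A = (v0 + 2 * K / \<epsilon>) * (2 * (N + 1) / \<delta>) powr \<gamma>"
    using k \<epsilon> by (simp add: A_def \<delta>_def field_simps)
  have A0: "0 \<le> A" using nonneg \<epsilon> by (simp add: A_def)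
  have "1 - \<epsilon> / 2 \<le> (1 - \<delta>) ^ k"
    using Bernoulli_inequality[of "- \<delta>" k] \<delta> k by (simp add: \<delta>_def field_simps)
  also have "\<dots> \<le> (1 - \<delta>) powr \<gamma>"
    using \<delta> \<gamma> powr_mono'[of \<gamma> "real k" "1 - \<delta>"] by (simp add: powr_realpow)
  finally have bern: "1 - \<epsilon> / 2 \<le> (1 - \<delta>) powr \<gamma>" .
  have "osc n (A * real n powr - \<gamma>)" using n
  proof (induction n rule: less_induct)
    case (less n)
    show ?case
    proof (cases "2 * (N + 1) / \<delta> \<le> n")
      case False
      \<comment> \<open>Below the threshold the trivial bound \<open>v0\<close> suffices: the factor
        \<open>(2 * (N + 1) / \<delta>) powr \<gamma>\<close> of \<open>A\<close> outweighs
        \<open>real n powr - \<gamma>\<close> there.\<close>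
      have "v0 * 1 \<le> (v0 + 2 * K / \<epsilon>) * ((2 * (N + 1) / \<delta>) powr \<gamma> * real n powr - \<gamma>)"
      proof (rule mult_mono)
        have "real n powr \<gamma> \<le> (2 * (N + 1) / \<delta>) powr \<gamma>"
          using False \<gamma> less.prems by (intro powr_mono2) auto
        then show "1 \<le> (2 * (N + 1) / \<delta>) powr \<gamma> * real n powr - \<gamma>"
          using less.prems by (simp add: powr_minus field_simps)
      qed (use nonneg \<epsilon> in auto)
      then show ?thesis using osc_mono[OF osc0] by (simp add: A mult_ac)
    next
      case True
      then have "2 * (real N + 1) \<le> \<delta> * n" using \<delta> by (simp add: field_simps)
      moreover define X where "X = \<delta> * real n"
      ultimately have big: "2 * (real N + 1) \<le> X" by simp
      have X0: "0 \<le> X" and X2: "X \<le> n / 2"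
        using \<delta> mult_right_mono[of \<delta> "1/2" "real n"] by (auto simp: X_def)
      \<comment> \<open>\<open>N + m\<close> is the integer part of \<open>\<delta> * n\<close>.
        Then \<open>l \<ge> (1 - \<delta>) * n\<close>, and since the threshold gives
        \<open>N + 1 \<le> X / 2\<close>, also \<open>m \<ge> X / 2\<close>.\<close>
      define j where "j = nat \<lfloor>X\<rfloor>"
      define m where "m = j - N"
      define l where "l = n - (N + m)"
      have fl: "real j \<le> X" "X - 1 \<le> real j" using X0 by (auto simp: j_def)
      have N: "N \<le> j" using big fl by simp
      have m: "X / 2 \<le> m" "real m + N \<le> X" using fl big N by (auto simp: m_def of_nat_diff)
      have m1: "1 \<le> m" using m big by simp
      have "N + m \<le> n" using m X2 by simp
      then have nl: "n = N + m + l" and l_eq: "real l = n - (N + m)" by (auto simp: l_def of_nat_diff)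
      have l: "(1 - \<delta>) * n \<le> l" using l_eq m by (simp add: X_def left_diff_distrib)
      have l0: "0 < (1 - \<delta>) * n" using \<delta> less.prems by simp
      have "0 < real l" using l0 l by (rule less_le_trans)
      then have "osc l (A * real l powr - \<gamma>)" using m1 nl by (intro less.IH) auto
      then have "osc l (A * ((1 - \<delta>) powr - \<gamma> * real n powr - \<gamma>))"
        using powr_mono2'[of "- \<gamma>" _ l, OF _ l0 l] \<gamma> A0 \<delta>
        by (elim osc_mono) (auto intro!: mult_left_mono simp: powr_mult)
      from step[OF m1 this] have *: "osc n ((1 - \<epsilon>) * (A * ((1 - \<delta>) powr - \<gamma> * real n powr - \<gamma>))
          + K * real m powr - \<gamma>)" by (simp add: nl)
      \<comment> \<open>As \<open>1 - \<epsilon>\<close> is at most the square of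
        \<open>1 - \<epsilon> / 2\<close>, one factor \<open>1 - \<epsilon> / 2\<close> absorbs the
        loss \<open>(1 - \<delta>) powr - \<gamma>\<close>, and the other leaves room
        \<open>\<epsilon> / 2\<close> for the error term with \<open>K\<close>.\<close>
      have "(1 - \<epsilon>) * (1 - \<delta>) powr - \<gamma> \<le> 1 - \<epsilon> / 2"
      proof -
        have "1 - \<epsilon> \<le> (1 - \<epsilon> / 2) * (1 - \<epsilon> / 2)" by (simp add: algebra_simps)
        also have "\<dots> \<le> (1 - \<epsilon> / 2) * (1 - \<delta>) powr \<gamma>" using bern \<epsilon> by (intro mult_left_mono) auto
        finally show ?thesis using \<delta> by (simp add: powr_minus field_simps)
      qed
      from mult_right_mono[OF this, of "A * real n powr - \<gamma>"]
      have 1: "(1 - \<epsilon>) * (A * ((1 - \<delta>) powr - \<gamma> * real n powr - \<gamma>)) \<le> (1 - \<epsilon> / 2) * A * real n powr - \<gamma>"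
        using A0 by (simp add: mult_ac)
      have "real m powr - \<gamma> \<le> (\<delta> * n / 2) powr - \<gamma>"
        using m \<delta> less.prems \<gamma> by (intro powr_mono2') (auto simp: X_def)
      also have "\<dots> = (2 / \<delta>) powr \<gamma> * real n powr - \<gamma>"
        using \<delta> less.prems by (simp add: powr_minus powr_divide powr_mult field_simps)
      also have "\<dots> \<le> (2 * (N + 1) / \<delta>) powr \<gamma> * real n powr - \<gamma>"
        using \<delta> \<gamma> by (intro mult_right_mono powr_mono2 divide_right_mono) auto
      finally have "K * real m powr - \<gamma> \<le> K * ((2 * (N + 1) / \<delta>) powr \<gamma> * real n powr - \<gamma>)"
        using nonneg by (intro mult_left_mono) auto
      also have "\<dots> \<le> \<epsilon> / 2 * A * real n powr - \<gamma>"
      proof -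
        \<comment> \<open>The summand \<open>2 * K / \<epsilon>\<close> of \<open>A\<close> is
          chosen for this estimate.\<close>
        have "K \<le> \<epsilon> / 2 * (v0 + 2 * K / \<epsilon>)" using \<epsilon> nonneg by (simp add: field_simps)
        from mult_right_mono[OF this, of "(2 * (N + 1) / \<delta>) powr \<gamma> * real n powr - \<gamma>"]
        show ?thesis by (simp add: A mult_ac)
      qed
      finally show ?thesis using 1 by (intro osc_mono[OF *]) (simp add: algebra_simps)
    qed
  qed
  then show ?thesis by (simp add: A_def)
qed

section \<open>Paired preimages and contraction of oscillations\<close>

text \<open>Besides expansivity, this collects what the oscillation estimates use of compactness and
  mixing. Both \<open>D\<close> and the hitting time \<open>N\<close> are uniform over the space and
  independent of any potential, so that \<kappa> can be fixed before the potential.\<close>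

locale ruelle_system =
  fixes T :: "'a::metric_space \<Rightarrow> 'a" and c :: "nat \<Rightarrow> real \<Rightarrow> real" and r :: real and D N :: nat
  assumes dist_le_1: "dist x (y::'a) \<le> 1"
    and expansive: "ruelle_expansive c r T"
    and finite_fibre: "finite {y. T y = x}"
    and card_fibre: "card {y. T y = x} \<le> D"
    and N_pos: "1 \<le> N"
    and hit: "\<exists>y. (T ^^ N) y = x \<and> dist y z < r"
begin

text \<open>The scale \<open>t\<close> is a separate parameter, so that pieces of a shadowing pair
  of orbits are still measured by the distance of the original end points.\<close>

definition shadows :: "nat \<Rightarrow> real \<Rightarrow> 'a \<Rightarrow> 'a \<Rightarrow> bool" where
  "shadows n t x y \<longleftrightarrow> (\<forall>k\<le>n. dist ((T ^^ k) x) ((T ^^ k) y) \<le> c (n - k) t)"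

lemma shadows_sym: "shadows n t x y \<longleftrightarrow> shadows n t y x"
  by (simp add: shadows_def dist_commute)

lemma shadows_iterate: "shadows (m + l) t x y \<Longrightarrow> shadows m t ((T ^^ l) x) ((T ^^ l) y)"
  unfolding shadows_def by (metis add_le_cancel_right diff_add_inverse2 diff_cancel2 funpow_add o_apply)

lemma surj_iterate: "\<exists>y. (T ^^ n) y = x"
proof (induction n arbitrary: x)
  case (Suc n)
  obtain y where y: "(T ^^ N) y = x" using hit by blast
  obtain k where "N = Suc k" using N_pos by (cases N) auto
  with y have "T ((T ^^ k) y) = x" by simp
  moreover obtain z where "(T ^^ n) z = (T ^^ k) y" using Suc by blast
  ultimately have "(T ^^ Suc n) z = x" by simp
  then show ?case by blast
qed simp

lemma ex1_shadow:
  assumes "1 \<le> n" "dist x y < r" "(T ^^ n) x' = x"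
  shows "\<exists>!y'. (T ^^ n) y' = y \<and> shadows n (dist x y) x' y'"
  using expansive assms unfolding ruelle_expansive_def shadows_def by blast

text \<open>Shadowing is symmetric, so by uniqueness the shadow of the shadow of \<open>z\<close> is
  \<open>z\<close> again. The shadow maps in the two directions are therefore mutually
  inverse.\<close>

lemma pairing:
  assumes "1 \<le> n" "dist x y < r"
  obtains \<phi> where "bij_betw \<phi> {z. (T ^^ n) z = x} {z. (T ^^ n) z = y}"
    "\<And>z. (T ^^ n) z = x \<Longrightarrow> shadows n (dist x y) z (\<phi> z)"
proof -
  have yr: "dist y x < r" using assms by (simp add: dist_commute)
  define \<phi> where "\<phi> z = (THE y'. (T ^^ n) y' = y \<and> shadows n (dist x y) z y')" for z
  define \<psi> where "\<psi> z = (THE y'. (T ^^ n) y' = x \<and> shadows n (dist y x) z y')" for z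
  have \<phi>: "(T ^^ n) (\<phi> z) = y \<and> shadows n (dist x y) z (\<phi> z)" if "(T ^^ n) z = x" for z
    unfolding \<phi>_def by (rule theI'[OF ex1_shadow[OF assms that]])
  have \<psi>: "(T ^^ n) (\<psi> z) = x \<and> shadows n (dist y x) z (\<psi> z)" if "(T ^^ n) z = y" for z
    unfolding \<psi>_def by (rule theI'[OF ex1_shadow[OF assms(1) yr that]])
  have "\<psi> (\<phi> z) = z" if "(T ^^ n) z = x" for z
    using ex1_shadow[OF assms(1) yr, of "\<phi> z"] \<phi>[OF that] \<psi>[of "\<phi> z"] that
    by (metis dist_commute shadows_sym)
  moreover have "\<phi> (\<psi> z) = z" if "(T ^^ n) z = y" for z
    using ex1_shadow[OF assms, of "\<psi> z"] \<psi>[OF that] \<phi>[of "\<psi> z"] that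
    by (metis dist_commute shadows_sym)
  ultimately have "bij_betw \<phi> {z. (T ^^ n) z = x} {z. (T ^^ n) z = y}"
    using \<phi> \<psi> by (intro bij_betw_byWitness[where f' = \<psi>]) auto
  with \<phi> show thesis by (intro that) auto
qed

text \<open>Uniqueness at order \<open>m\<close> forces the pairing of order \<open>m + l\<close> to
  map the fibre over \<open>x'\<close> onto the fibre over \<open>y'\<close>. Paired points thus
  shadow each other at order \<open>m + l\<close>, not merely at order \<open>l\<close>, which makes
  all differences small for large \<open>m\<close>.\<close>

lemma pairing_restrict:
  assumes m: "1 \<le> m" and xy: "dist x y < r" "(T ^^ m) x' = x" "(T ^^ m) y' = y" "shadows m (dist x y) x' y'"
  obtains \<phi> where "bij_betw \<phi> {z. (T ^^ l) z = x'} {z. (T ^^ l) z = y'}"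
    "\<And>z. (T ^^ l) z = x' \<Longrightarrow> shadows (m + l) (dist x y) z (\<phi> z)"
proof -
  from m have "1 \<le> m + l" by simp
  from pairing[OF this xy(1)] obtain \<phi> where
    \<phi>: "bij_betw \<phi> {z. (T ^^ (m + l)) z = x} {z. (T ^^ (m + l)) z = y}"
    "\<And>z. (T ^^ (m + l)) z = x \<Longrightarrow> shadows (m + l) (dist x y) z (\<phi> z)" by blast
  have yr: "dist y x < r" using xy by (simp add: dist_commute)
  have 1: "(T ^^ l) (\<phi> z) = y'" if "(T ^^ l) z = x'" for z
  proof -
    have z: "(T ^^ (m + l)) z = x" using that xy by (simp add: funpow_add)
    have "(T ^^ m) ((T ^^ l) (\<phi> z)) = y" using bij_betwE[OF \<phi>(1)] z by (simp add: funpow_add)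
    moreover have "shadows m (dist x y) x' ((T ^^ l) (\<phi> z))"
      using shadows_iterate[OF \<phi>(2)[OF z]] that by simp
    ultimately show ?thesis using ex1_shadow[OF m xy(1,2)] xy(3,4) by blast
  qed
  have 2: "(T ^^ l) z = x'" if "(T ^^ (m + l)) z = x" "(T ^^ l) (\<phi> z) = y'" for z
  proof -
    have "(T ^^ m) ((T ^^ l) z) = x" using that by (simp add: funpow_add)
    moreover have "shadows m (dist y x) y' ((T ^^ l) z)"
      using shadows_iterate[OF \<phi>(2)[OF that(1)]] that(2) by (simp add: shadows_sym dist_commute)
    moreover have "shadows m (dist y x) y' x'" using xy(4) by (simp add: shadows_sym dist_commute)
    ultimately show ?thesis using ex1_shadow[OF m yr xy(3)] xy(2) by blast
  qed
  have sub: "{z. (T ^^ l) z = x'} \<subseteq> {z. (T ^^ (m + l)) z = x}" using xy by (auto simp: funpow_add)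
  have "\<phi> ` {z. (T ^^ l) z = x'} = {z. (T ^^ l) z = y'}"
  proof (intro equalityI subsetI)
    fix w assume "w \<in> {z. (T ^^ l) z = y'}"
    then have "w \<in> {z. (T ^^ (m + l)) z = y}" using xy by (auto simp: funpow_add)
    then obtain z where "(T ^^ (m + l)) z = x" "w = \<phi> z"
      using \<phi>(1) by (auto simp: bij_betw_def)
    then show "w \<in> \<phi> ` {z. (T ^^ l) z = x'}" using 2 \<open>w \<in> {z. (T ^^ l) z = y'}\<close> by auto
  qed (use 1 in auto)
  then have "bij_betw \<phi> {z. (T ^^ l) z = x'} {z. (T ^^ l) z = y'}"
    using bij_betw_subset[OF \<phi>(1) sub] by simp
  then show thesis using \<phi>(2) sub by (intro that) auto
qed

lemmas finite_fibres = finite_fibre_iterate[OF finite_fibre]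

lemmas card_fibres = card_fibre_iterate_le[OF finite_fibre card_fibre]

lemma D_pos: "1 \<le> D"
proof -
  fix x
  obtain y where "T y = x" using surj_iterate[of 1 x] by auto
  then have "0 < card {y. T y = x}" using finite_fibre by (subst card_gt_0_iff) auto
  then show ?thesis using card_fibre[of x] by linarith
qed

end

text \<open>The exponent \<open>- (\<gamma> + 1)\<close> is summable over the times of an orbit and
  leaves tails of order \<open>m powr - \<gamma>\<close>. The constant \<open>C\<close> will be a
  fixed multiple of the Hoelder coefficient of \<open>a\<close>, so the estimates keep track of
  it.\<close>

locale ruelle_potential = ruelle_system T c r D N
  for T :: "'a::metric_space \<Rightarrow> 'a" and c r D N +
  fixes a :: "'a \<Rightarrow> real" and C \<gamma> :: real
  assumes C_nonneg: "0 \<le> C" and \<gamma>_pos: "0 < \<gamma>"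
    and potential_bound: "\<bar>a x - a y\<bar> \<le> C"
    and potential_decay: "1 \<le> j \<Longrightarrow> 0 \<le> t \<Longrightarrow> t \<le> 1 \<Longrightarrow> dist x y \<le> c j t \<Longrightarrow>
      \<bar>a x - a y\<bar> \<le> C * real j powr - (\<gamma> + 1)"
begin

abbreviation "S \<equiv> birkhoff_sum T a"

text \<open>The distortion constant: it bounds the difference of Birkhoff sums along shadowing
  orbits of any length.\<close>

definition E0 :: real where "E0 = C * (1 + 1 / \<gamma>)"

definition g :: "nat \<Rightarrow> 'a \<Rightarrow> real" where
  "g n x = (transfer_op T a ^^ n) (\<lambda>_. 1) x"

definition Q :: "('a \<Rightarrow> real) \<Rightarrow> nat \<Rightarrow> 'a \<Rightarrow> real" where
  "Q f n x = (transfer_op T a ^^ n) f x / g n x"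

lemma E0_nonneg: "0 \<le> E0"
  using C_nonneg \<gamma>_pos by (simp add: E0_def)

lemma g_eq: "g n x = (\<Sum>z | (T ^^ n) z = x. exp (S n z))"
  by (simp add: g_def transfer_op_iterate[OF finite_fibre])

lemma g_0 [simp]: "g 0 x = 1"
  by (simp add: g_def)

lemma g_pos: "0 < g n x"
  unfolding g_eq using surj_iterate by (intro sum_pos) (auto simp: finite_fibres)

lemma iterate_add:
  "(transfer_op T a ^^ (m + l)) f x = (\<Sum>y | (T ^^ m) y = x. exp (S m y) * (transfer_op T a ^^ l) f y)"
  by (simp add: funpow_add transfer_op_iterate[OF finite_fibre, where n = m])

lemma g_add: "g (m + l) x = (\<Sum>y | (T ^^ m) y = x. exp (S m y) * g l y)"
  unfolding g_def by (rule iterate_add)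

lemma Q_add:
  "Q f (m + l) x = (\<Sum>y | (T ^^ m) y = x. (exp (S m y) * g l y) * Q f l y)
    / (\<Sum>y | (T ^^ m) y = x. exp (S m y) * g l y)"
  unfolding Q_def[of f "m + l"] g_add iterate_add
  using g_pos[of l] by (simp add: Q_def less_imp_neq[symmetric])

lemma Q_0 [simp]: "Q f 0 x = f x"
  by (simp add: Q_def)

section \<open>Bounded distortion along paired orbits\<close>

lemma birkhoff_diff_le:
  assumes "shadows (m + l) t z z'" "0 \<le> t" "t \<le> 1"
  shows "\<bar>S l z - S l z'\<bar> \<le> C * (\<Sum>k<l. real (m + l - k) powr - (\<gamma> + 1))"
proof -
  have "\<bar>S l z - S l z'\<bar> \<le> (\<Sum>k<l. \<bar>a ((T ^^ k) z) - a ((T ^^ k) z')\<bar>)"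
    unfolding birkhoff_sum_def sum_subtractf[symmetric] by (rule sum_abs)
  also have "\<dots> \<le> (\<Sum>k<l. C * real (m + l - k) powr - (\<gamma> + 1))"
    using assms by (intro sum_mono potential_decay) (auto simp: shadows_def)
  finally show ?thesis by (simp add: sum_distrib_left)
qed

lemma birkhoff_diff_le_E0:
  assumes "shadows n t z z'" "0 \<le> t" "t \<le> 1"
  shows "\<bar>S n z - S n z'\<bar> \<le> E0"
  using birkhoff_diff_le[of 0 n t z z'] assms sum_powr_le[OF \<gamma>_pos, of n] C_nonneg
  by (auto simp: E0_def intro: order_trans[OF _ mult_left_mono])

text \<open>Only the first \<open>l\<close> of \<open>m + l\<close> shadowed steps are summed. There
  the remaining order exceeds \<open>m\<close>, so a tail of the power sum appears.\<close>

lemma birkhoff_diff_le_tail: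
  assumes "shadows (m + l) t z z'" "0 \<le> t" "t \<le> 1" "1 \<le> m"
  shows "\<bar>S l z - S l z'\<bar> \<le> C * real m powr - \<gamma> / \<gamma>"
proof -
  have "(\<Sum>k<l. real (m + l - k) powr - (\<gamma> + 1)) \<le> real m powr - \<gamma> / \<gamma>"
    using sum_powr_tail_le[OF \<gamma>_pos assms(4), of l] \<gamma>_pos
    by (auto simp: diff_divide_distrib intro: order_trans)
  from mult_left_mono[OF this C_nonneg] birkhoff_diff_le[OF assms(1-3)] show ?thesis by simp
qed

text \<open>For the at most \<open>N\<close> steps in which the orbits need not shadow each
  other.\<close>

lemma birkhoff_diff_le_crude: "S n z - S n z' \<le> n * C"
proof -
  have "S n z - S n z' = (\<Sum>k<n. a ((T ^^ k) z) - a ((T ^^ k) z'))"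
    by (simp add: birkhoff_sum_def sum_subtractf)
  also have "\<dots> \<le> (\<Sum>k<n. C)"
    using potential_bound by (intro sum_mono) (metis abs_le_D1)
  finally show ?thesis by simp
qed

lemma exp_le_exp_mult: "s - s' \<le> E \<Longrightarrow> exp s \<le> exp E * exp (s'::real)"
  by (simp add: exp_add[symmetric])

lemma g_le_of_pairing:
  assumes \<phi>: "bij_betw \<phi> {z. (T ^^ n) z = x} {z. (T ^^ n) z = y}"
    and E: "\<And>z. (T ^^ n) z = x \<Longrightarrow> \<bar>S n z - S n (\<phi> z)\<bar> \<le> E"
  shows "g n x \<le> exp E * g n y" "g n y \<le> exp E * g n x"
proof -
  have y: "g n y = (\<Sum>z | (T ^^ n) z = x. exp (S n (\<phi> z)))"
    unfolding g_eq by (rule sum.reindex_bij_betw[OF \<phi>, symmetric])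
  show "g n x \<le> exp E * g n y" "g n y \<le> exp E * g n x"
    unfolding y unfolding g_eq sum_distrib_left using E
    by (auto intro!: sum_mono exp_le_exp_mult simp: abs_le_iff)
qed

lemma g_le_of_close:
  assumes "dist x y < r"
  shows "g n x \<le> exp E0 * g n y"
proof (cases "n = 0")
  case False
  then have n: "1 \<le> n" by simp
  from pairing[OF n assms] obtain \<phi> where
    \<phi>: "bij_betw \<phi> {z. (T ^^ n) z = x} {z. (T ^^ n) z = y}"
    "\<And>z. (T ^^ n) z = x \<Longrightarrow> shadows n (dist x y) z (\<phi> z)" by blast
  show ?thesis
    by (intro g_le_of_pairing[OF \<phi>(1)] birkhoff_diff_le_E0[OF \<phi>(2)]) (auto simp: dist_le_1)
qed (use E0_nonneg in simp)

text \<open>Numerator and denominator of \<open>Q f l\<close> are sums over preimages of order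
  \<open>l\<close>, and these are paired with shadowing order \<open>m + l\<close>. Both the
  distortion of the weights and the variation of \<open>f\<close> over a pair are then of order
  \<open>m powr - \<gamma>\<close>.\<close>

lemma shadowed_estimates:
  assumes m: "1 \<le> m" and xy: "dist x y < r" "(T ^^ m) x' = x" "(T ^^ m) y' = y"
      "shadows m (dist x y) x' y'"
    and f: "\<And>z. \<bar>f z\<bar> \<le> M"
      "\<And>j t z z'. 1 \<le> j \<Longrightarrow> 0 \<le> t \<Longrightarrow> t \<le> 1 \<Longrightarrow> dist z z' \<le> c j t \<Longrightarrow>
        \<bar>f z - f z'\<bar> \<le> M * real j powr - \<gamma>"
  shows "g l x' \<le> exp E0 * g l y'" "g l y' \<le> exp E0 * g l x'"
    "Q f l x' - Q f l y' \<le> M * (1 + 4 * C / \<gamma>) * real m powr - \<gamma>"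
proof -
  from pairing_restrict[OF m xy, of l] obtain \<phi> where
    \<phi>: "bij_betw \<phi> {z. (T ^^ l) z = x'} {z. (T ^^ l) z = y'}"
    "\<And>z. (T ^^ l) z = x' \<Longrightarrow> shadows (m + l) (dist x y) z (\<phi> z)" by blast
  have M: "0 \<le> M" using f(1)[of x] by linarith
  \<comment> \<open>That \<open>e\<close> is of order \<open>m powr - \<gamma>\<close> gives the
    third claim; its bound \<open>E0\<close> gives constants independent of \<open>m\<close> in the
    first two.\<close>
  define e where "e = C * real m powr - \<gamma> / \<gamma>"
  have e0: "0 \<le> e" using C_nonneg \<gamma>_pos by (simp add: e_def)
  have "real m powr - \<gamma> \<le> 1" using powr_mono2'[of "- \<gamma>" 1 m] m \<gamma>_pos by simp
  then have "C * real m powr - \<gamma> / \<gamma> \<le> C * 1 / \<gamma>"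
    using C_nonneg \<gamma>_pos by (intro divide_right_mono mult_left_mono) auto
  then have eE: "e \<le> E0" using C_nonneg by (simp add: e_def E0_def distrib_left)
  have diff: "\<bar>S l z - S l (\<phi> z)\<bar> \<le> e" if "(T ^^ l) z = x'" for z
    unfolding e_def using \<phi>(2)[OF that] m by (intro birkhoff_diff_le_tail) (auto simp: dist_le_1)
  show "g l x' \<le> exp E0 * g l y'" "g l y' \<le> exp E0 * g l x'"
    using g_le_of_pairing[OF \<phi>(1)] diff eE by (meson order_trans)+
  have "Q f l x' - Q f l y' \<le> exp (- 2 * e) * (M * real m powr - \<gamma>) + (1 - exp (- 2 * e)) * (2 * M)"
  proof -
    have y: "Q f l y' = (\<Sum>z | (T ^^ l) z = x'. exp (S l (\<phi> z)) * f (\<phi> z))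
        / (\<Sum>z | (T ^^ l) z = x'. exp (S l (\<phi> z)))"
      unfolding Q_def g_eq transfer_op_iterate[OF finite_fibre]
      using sum.reindex_bij_betw[OF \<phi>(1), of "\<lambda>z. exp (S l z) * f z"]
        sum.reindex_bij_betw[OF \<phi>(1), of "\<lambda>z. exp (S l z)"] by simp
    have x: "Q f l x' = (\<Sum>z | (T ^^ l) z = x'. exp (S l z) * f z) / (\<Sum>z | (T ^^ l) z = x'. exp (S l z))"
      unfolding Q_def g_eq transfer_op_iterate[OF finite_fibre] ..
    show ?thesis unfolding x y
    proof (rule weighted_ratio_diff_le)
      fix z assume "z \<in> {z. (T ^^ l) z = x'}"
      then have z: "(T ^^ l) z = x'" by simp
      show "exp (S l z) \<le> exp e * exp (S l (\<phi> z))" "exp (S l (\<phi> z)) \<le> exp e * exp (S l z)"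
        using diff[OF z] by (auto intro!: exp_le_exp_mult)
      have "dist z (\<phi> z) \<le> c (m + l) (dist x y)" using \<phi>(2)[OF z] unfolding shadows_def by force
      then have "\<bar>f z - f (\<phi> z)\<bar> \<le> M * real (m + l) powr - \<gamma>"
        using m dist_le_1 by (intro f(2)) auto
      also have "\<dots> \<le> M * real m powr - \<gamma>"
        using m M \<gamma>_pos by (intro mult_left_mono powr_mono2') auto
      finally show "f z - f (\<phi> z) \<le> M * real m powr - \<gamma>" by linarith
    next
      fix z z'
      show "f z - f (\<phi> z') \<le> 2 * M" using f(1)[of z] f(1)[of "\<phi> z'"] by linarith
    qed (use e0 surj_iterate finite_fibres in auto)
  qed
  \<comment> \<open>\<open>1 - exp (- 2 * e) \<le> 2 * e\<close> turns the uncoupled mass into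
    another term of order \<open>m powr - \<gamma>\<close>.\<close>
  also have "\<dots> \<le> 1 * (M * real m powr - \<gamma>) + (2 * e) * (2 * M)"
    using e0 M exp_ge_add_one_self[of "- 2 * e"] by (intro add_mono mult_right_mono) auto
  also have "\<dots> = M * (1 + 4 * C / \<gamma>) * real m powr - \<gamma>"
    by (simp add: e_def algebra_simps)
  finally show "Q f l x' - Q f l y' \<le> M * (1 + 4 * C / \<gamma>) * real m powr - \<gamma>" .
qed

text \<open>The weights \<open>exp (S m z) * g l z\<close> of paired points carry the distortion
  \<open>E0\<close> twice, from \<open>S m\<close> and from \<open>g l\<close>, and normalisation
  doubles this: hence \<open>4 * E0\<close>. The coupled mass sees only the small variation of
  \<open>Q f l\<close> over a pair, the rest the full oscillation \<open>v\<close>.\<close>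

lemma Q_diff_le_of_close:
  assumes m: "1 \<le> m" and xy: "dist x y < r"
    and f: "\<And>z. \<bar>f z\<bar> \<le> M"
      "\<And>j t z z'. 1 \<le> j \<Longrightarrow> 0 \<le> t \<Longrightarrow> t \<le> 1 \<Longrightarrow> dist z z' \<le> c j t \<Longrightarrow>
        \<bar>f z - f z'\<bar> \<le> M * real j powr - \<gamma>"
    and osc: "\<And>x y. Q f l x - Q f l y \<le> v"
  shows "Q f (m + l) x - Q f (m + l) y
    \<le> exp (- 4 * E0) * (M * (1 + 4 * C / \<gamma>) * real m powr - \<gamma>) + (1 - exp (- 4 * E0)) * v"
proof -
  from pairing[OF m xy] obtain \<phi> where
    \<phi>: "bij_betw \<phi> {z. (T ^^ m) z = x} {z. (T ^^ m) z = y}"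
    "\<And>z. (T ^^ m) z = x \<Longrightarrow> shadows m (dist x y) z (\<phi> z)" by blast
  have Ty: "(T ^^ m) (\<phi> z) = y" if "(T ^^ m) z = x" for z using bij_betwE[OF \<phi>(1)] that by auto
  have eq: "(\<Sum>z | (T ^^ m) z = y. F z) = (\<Sum>z | (T ^^ m) z = x. F (\<phi> z))" for F :: "'a \<Rightarrow> real"
    by (rule sum.reindex_bij_betw[OF \<phi>(1), symmetric])
  have "Q f (m + l) x - Q f (m + l) y
    \<le> exp (- 2 * (2 * E0)) * (M * (1 + 4 * C / \<gamma>) * real m powr - \<gamma>) + (1 - exp (- 2 * (2 * E0))) * v"
    unfolding Q_add eq
  proof (rule weighted_ratio_diff_le)
    fix z assume "z \<in> {z. (T ^^ m) z = x}"
    then have z: "(T ^^ m) z = x" by simp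
    note est = shadowed_estimates[OF m xy z Ty[OF z] \<phi>(2)[OF z] f, where l = l]
    show "Q f l z - Q f l (\<phi> z) \<le> M * (1 + 4 * C / \<gamma>) * real m powr - \<gamma>" by (rule est)
    have d: "\<bar>S m z - S m (\<phi> z)\<bar> \<le> E0"
      using \<phi>(2)[OF z] by (intro birkhoff_diff_le_E0) (auto simp: dist_le_1)
    have "exp (S m z) * g l z \<le> (exp E0 * exp (S m (\<phi> z))) * (exp E0 * g l (\<phi> z))"
      using d est(1) g_pos by (intro mult_mono exp_le_exp_mult) (auto simp: less_imp_le)
    then show "exp (S m z) * g l z \<le> exp (2 * E0) * (exp (S m (\<phi> z)) * g l (\<phi> z))"
      by (simp add: mult_ac exp_double power2_eq_square)
    have "exp (S m (\<phi> z)) * g l (\<phi> z) \<le> (exp E0 * exp (S m z)) * (exp E0 * g l z)"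
      using d est(2) g_pos by (intro mult_mono exp_le_exp_mult) (auto simp: less_imp_le)
    then show "exp (S m (\<phi> z)) * g l (\<phi> z) \<le> exp (2 * E0) * (exp (S m z) * g l z)"
      by (simp add: mult_ac exp_double power2_eq_square)
  qed (use E0_nonneg surj_iterate finite_fibres g_pos osc in auto)
  then show ?thesis by simp
qed

section \<open>Comparability of distant points and contraction of oscillations\<close>

definition G :: real where "G = real D ^ N * exp (N * C + E0)"

text \<open>By \<open>hit\<close>, every preimage of \<open>x\<close> of order \<open>N\<close> is
  close to some preimage of \<open>y\<close> of order \<open>N\<close>, and \<open>g l\<close> is
  comparable at close points. So each of the at most \<open>D ^ N\<close> terms for \<open>x\<close>
  is bounded by a multiple of the whole sum for \<open>y\<close>. For \<open>n < N\<close> crude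
  bounds suffice.\<close>

lemma g_le: "g n x \<le> G * g n y"
proof -
  have sum_le: "(\<Sum>z | (T ^^ k) z = x. F z) \<le> real D ^ k * b"
    if "\<And>z. (T ^^ k) z = x \<Longrightarrow> F z \<le> b" "0 \<le> b" for F b k
  proof -
    have "(\<Sum>z | (T ^^ k) z = x. F z) \<le> card {z. (T ^^ k) z = x} * b"
      using that by (intro sum_bounded_above) auto
    also have "\<dots> \<le> real (D ^ k) * b"
      using that card_fibres by (intro mult_right_mono) auto
    finally show ?thesis by simp
  qed
  have C0: "0 \<le> real k * C" for k :: nat using C_nonneg by simp
  show ?thesis
  proof (cases "n < N")
    case True
    obtain y' where y': "(T ^^ n) y' = y" using surj_iterate by blast
    have "g n x \<le> real D ^ n * (exp (n * C) * exp (S n y'))"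
      unfolding g_eq by (intro sum_le exp_le_exp_mult birkhoff_diff_le_crude) auto
    also have "\<dots> \<le> real D ^ N * (exp (N * C + E0) * g n y)"
    proof (intro mult_mono power_increasing)
      show "exp (real n * C) \<le> exp (real N * C + E0)"
        using True C_nonneg E0_nonneg mult_right_mono[of n N C] by simp
      show "exp (S n y') \<le> g n y"
        unfolding g_eq using y' finite_fibres by (intro member_le_sum) auto
    qed (use True D_pos in auto)
    finally show ?thesis by (simp add: G_def)
  next
    case False
    then obtain l where n: "n = N + l" using le_Suc_ex not_less by blast
    have "g n x \<le> real D ^ N * (exp (N * C + E0) * g n y)"
      unfolding n g_add[of N l x]
    proof (rule sum_le)
      fix z assume "(T ^^ N) z = x"
      obtain w where w: "(T ^^ N) w = y" "dist w z < r" using hit by blast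
      have "exp (S N z) * g l z \<le> (exp (N * C) * exp (S N w)) * (exp E0 * g l w)"
        using w g_pos by (intro mult_mono exp_le_exp_mult birkhoff_diff_le_crude g_le_of_close)
          (auto simp: dist_commute less_imp_le)
      also have "\<dots> = exp (N * C + E0) * (exp (S N w) * g l w)" by (simp add: exp_add)
      also have "\<dots> \<le> exp (N * C + E0) * g (N + l) y"
        unfolding g_add[of N l y] using w finite_fibres g_pos
        by (intro mult_left_mono member_le_sum) (auto simp: less_imp_le)
      finally show "exp (S N z) * g l z \<le> exp (N * C + E0) * g (N + l) y" .
    qed (use g_pos in \<open>auto simp: less_imp_le\<close>)
    then show ?thesis by (simp add: G_def)
  qed
qed

text \<open>Transition probabilities from a point to its preimages of order \<open>m\<close>. They
  depend on \<open>l\<close>, so the lower bound below has to be uniform in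
  \<open>l\<close>.\<close>

definition weight :: "nat \<Rightarrow> nat \<Rightarrow> 'a \<Rightarrow> real" where
  "weight m l z = exp (S m z) * g l z / g (m + l) ((T ^^ m) z)"

lemma weight_pos: "0 < weight m l z"
  using g_pos by (simp add: weight_def)

lemma sum_weight: "(\<Sum>z | (T ^^ m) z = x. weight m l z) = 1"
  using g_pos[of "m + l" x] by (simp add: weight_def sum_divide_distrib[symmetric] g_add[symmetric])

lemma Q_eq_average: "Q f (m + l) x = (\<Sum>z | (T ^^ m) z = x. weight m l z * Q f l z)"
  by (simp add: Q_add weight_def sum_divide_distrib g_add[symmetric])

definition \<eta> :: real where "\<eta> = inverse (real D ^ N * exp (N * C) * G)"

text \<open>The sum \<open>g (N + l) x\<close> has at most \<open>D ^ N\<close> terms, each at most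
  \<open>exp (N * C) * G\<close> times the term of \<open>z\<close>.\<close>

lemma weight_ge: "\<eta> \<le> weight N l z"
proof -
  define x where "x = (T ^^ N) z"
  have D0: "0 < real D" using D_pos by simp
  have G: "0 < G" using D0 by (simp add: G_def)
  have "g (N + l) x \<le> (\<Sum>y | (T ^^ N) y = x. (exp (N * C) * exp (S N z)) * (G * g l z))"
    unfolding g_add using g_pos
    by (intro sum_mono mult_mono exp_le_exp_mult birkhoff_diff_le_crude g_le) (auto simp: less_imp_le)
  also have "\<dots> \<le> real (D ^ N) * ((exp (N * C) * exp (S N z)) * (G * g l z))"
    unfolding sum_constant using card_fibres g_pos[of l z] G
    by (intro mult_right_mono) auto
  finally have "g (N + l) x \<le> (real D ^ N * exp (N * C) * G) * (exp (S N z) * g l z)"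
    by (simp add: mult_ac)
  then show ?thesis
    unfolding weight_def x_def[symmetric] \<eta>_def using D0 G g_pos[of "N + l" x]
    by (simp add: field_simps)
qed

lemma osc_add_le:
  assumes "\<And>x y. Q f l x - Q f l y \<le> v"
  shows "Q f (m + l) x - Q f (m + l) y \<le> v"
proof -
  obtain z z' where "(T ^^ m) z = x" "(T ^^ m) z' = y" using surj_iterate by metis
  \<comment> \<open>The estimate for atoms with \<open>0\<close> in place of \<eta>: averaging does
    not increase the oscillation.\<close>
  then have "Q f (m + l) x - Q f (m + l) y \<le> 0 * (Q f l z - Q f l z') + (1 - 0) * v"
    unfolding Q_eq_average using assms
    by (intro weighted_average_diff_le_of_atoms) (auto simp: finite_fibres sum_weight weight_pos less_imp_le)
  then show ?thesis by simp
qed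

lemma eta_bounds: "0 < \<eta>" "\<eta> \<le> 1"
proof -
  have "1 \<le> real D ^ N * exp (real N * C)" "1 \<le> G"
    unfolding G_def using D_pos C_nonneg E0_nonneg by (auto intro!: mult_ge1_I one_le_power)
  then have "1 \<le> real D ^ N * exp (real N * C) * G" by (rule mult_ge1_I)
  then show "0 < \<eta>" "\<eta> \<le> 1" unfolding \<eta>_def by (auto simp del: inverse_mult_distrib simp: inverse_le_1_iff)
qed

text \<open>The gain is a product of two coupled shares: \<eta> for the pair of close preimages
  reached in \<open>N\<close> steps, and \<open>exp (- 4 * E0)\<close> for the pairing over the next
  \<open>m\<close> steps.\<close>

lemma osc_contraction:
  assumes m: "1 \<le> m"
    and f: "\<And>z. \<bar>f z\<bar> \<le> M"
      "\<And>j t z z'. 1 \<le> j \<Longrightarrow> 0 \<le> t \<Longrightarrow> t \<le> 1 \<Longrightarrow> dist z z' \<le> c j t \<Longrightarrow>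
        \<bar>f z - f z'\<bar> \<le> M * real j powr - \<gamma>"
    and osc: "\<And>x y. Q f l x - Q f l y \<le> v"
  shows "Q f (N + m + l) x - Q f (N + m + l) y
    \<le> (1 - \<eta> * exp (- 4 * E0)) * v + M * (1 + 4 * C / \<gamma>) * real m powr - \<gamma>"
proof -
  define d where "d = M * (1 + 4 * C / \<gamma>) * real m powr - \<gamma>"
  define q where "q = exp (- 4 * E0)"
  have M: "0 \<le> M" using f(1)[of x] by linarith
  have d: "0 \<le> d" using M C_nonneg \<gamma>_pos by (simp add: d_def)
  have q: "0 \<le> q" "q \<le> 1" using E0_nonneg by (auto simp: q_def)
  obtain y' where y': "(T ^^ N) y' = y" using surj_iterate by blast
  obtain x' where x': "(T ^^ N) x' = x" "dist x' y' < r" using hit by blast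
  have "Q f (N + (m + l)) x - Q f (N + (m + l)) y
      \<le> \<eta> * (Q f (m + l) x' - Q f (m + l) y') + (1 - \<eta>) * v"
    unfolding Q_eq_average[of f N] using x' y' osc_add_le[OF osc]
    by (intro weighted_average_diff_le_of_atoms)
      (auto simp: finite_fibres sum_weight weight_pos less_imp_le weight_ge)
  also have "\<dots> \<le> \<eta> * (q * d + (1 - q) * v) + (1 - \<eta>) * v"
    using Q_diff_le_of_close[OF m x'(2) f osc] eta_bounds
    by (intro add_right_mono mult_left_mono) (auto simp: q_def d_def)
  also have "\<dots> = (1 - \<eta> * q) * v + (\<eta> * q) * d" by (simp add: algebra_simps)
  also have "\<dots> \<le> (1 - \<eta> * q) * v + 1 * d"
    using d q eta_bounds by (intro add_left_mono mult_right_mono mult_le_one) auto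
  finally show ?thesis by (simp add: q_def d_def add_ac)
qed

text \<open>\<open>E\<close> is the reciprocal of the gain written out, which exhibits the
  exponential dependence on \<open>C\<close>; \<open>exp (4 * C / \<gamma>)\<close> replaces
  \<open>1 + 4 * C / \<gamma>\<close> for the same purpose.\<close>

lemma osc_decay:
  assumes f: "\<And>z. \<bar>f z\<bar> \<le> M"
      "\<And>j t z z'. 1 \<le> j \<Longrightarrow> 0 \<le> t \<Longrightarrow> t \<le> 1 \<Longrightarrow> dist z z' \<le> c j t \<Longrightarrow>
        \<bar>f z - f z'\<bar> \<le> M * real j powr - \<gamma>"
    and k: "\<gamma> \<le> real k" and n: "1 \<le> n"
    and E: "E = real D ^ (2 * N) * exp (2 * N * C + 5 * E0)"
  shows "Q f n x - Q f n y
    \<le> 4 * M * exp (4 * C / \<gamma>) * E * (4 * real k * (real N + 1) * E) powr \<gamma> * real n powr - \<gamma>"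
proof -
  define \<epsilon> where "\<epsilon> = \<eta> * exp (- 4 * E0)"
  define K where "K = M * (1 + 4 * C / \<gamma>)"
  have M: "0 \<le> M" using f(1)[of x] by linarith
  have K: "0 \<le> K" using M C_nonneg \<gamma>_pos by (simp add: K_def)
  have \<epsilon>: "0 < \<epsilon>" "\<epsilon> \<le> 1"
    using eta_bounds E0_nonneg by (auto simp: \<epsilon>_def intro: mult_le_one)
  have "\<epsilon> * ((real D ^ N * exp (N * C)) * (real D ^ N * exp (N * C + E0)) * exp (4 * E0)) = 1"
    using D_pos unfolding \<epsilon>_def \<eta>_def G_def
    by (simp add: divide_simps exp_minus)
  also have "(real D ^ N * exp (N * C)) * (real D ^ N * exp (N * C + E0)) * exp (4 * E0)
    = real D ^ (N + N) * exp (N * C + (N * C + E0) + 4 * E0)"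
    by (simp only: power_add exp_add mult_ac)
  also have "N * C + (N * C + E0) + 4 * E0 = 2 * N * C + 5 * E0" by simp
  also have "real D ^ (N + N) * exp (2 * N * C + 5 * E0) = E" by (simp only: E mult_2)
  finally have "\<epsilon> * E = 1" .
  then have E_eq: "E = 1 / \<epsilon>" using \<epsilon> by (simp add: field_simps)
  have "\<forall>x y. Q f n x - Q f n y \<le> (2 * M + 2 * K / \<epsilon>)
    * (4 * real k * (real N + 1) / \<epsilon>) powr \<gamma> * real n powr - \<gamma>"
  proof (rule polynomial_decay_of_block_contraction[where osc = "\<lambda>n v. \<forall>x y. Q f n x - Q f n y \<le> v"])
    fix n
    have *: "Q f 0 x - Q f 0 y \<le> 2 * M" for x y using f(1)[of x] f(1)[of y] by simp
    have "Q f (n + 0) x - Q f (n + 0) y \<le> 2 * M" for x y by (rule osc_add_le[OF *])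
    then show "\<forall>x y. Q f n x - Q f n y \<le> 2 * M" by simp
  next
    fix l m :: nat and v assume "1 \<le> m" "\<forall>x y. Q f l x - Q f l y \<le> v"
    then show "\<forall>x y. Q f (N + m + l) x - Q f (N + m + l) y \<le> (1 - \<epsilon>) * v + K * real m powr - \<gamma>"
      unfolding \<epsilon>_def K_def by (intro allI osc_contraction f) auto
  qed (use \<gamma>_pos k \<epsilon> M K n in \<open>auto intro: order_trans\<close>)
  then have "Q f n x - Q f n y \<le> (2 * M + 2 * K / \<epsilon>)
    * (4 * real k * (real N + 1) / \<epsilon>) powr \<gamma> * real n powr - \<gamma>" by blast
  also have "\<dots> \<le> (4 * M * exp (4 * C / \<gamma>) / \<epsilon>) * (4 * real k * (real N + 1) / \<epsilon>) powr \<gamma> * real n powr - \<gamma>"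
  proof (intro mult_right_mono)
    have "M \<le> M * exp (4 * C / \<gamma>)"
      using M C_nonneg \<gamma>_pos mult_left_mono[of 1 "exp (4 * C / \<gamma>)" M] by simp
    also have "\<dots> \<le> M * exp (4 * C / \<gamma>) / \<epsilon>"
      using \<epsilon> M by (simp add: pos_le_divide_eq mult_left_le)
    finally have "M \<le> M * exp (4 * C / \<gamma>) / \<epsilon>" .
    moreover have "K / \<epsilon> \<le> M * exp (4 * C / \<gamma>) / \<epsilon>"
      unfolding K_def using \<epsilon> M exp_ge_add_one_self[of "4 * C / \<gamma>"]
      by (intro divide_right_mono mult_left_mono) auto
    ultimately show "2 * M + 2 * K / \<epsilon> \<le> 4 * M * exp (4 * C / \<gamma>) / \<epsilon>" by simp
  qed auto
  finally show ?thesis by (simp add: E_eq)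
qed

end

section \<open>Moduli of continuity and the geometry of the map\<close>

lemma omega_pos:
  assumes "1 < t0" "0 < t" "t \<le> 1"
  shows "0 < omega \<alpha> \<beta> t0 t"
proof -
  have "ln t \<le> 0" "0 < ln t0" using assms by auto
  then show ?thesis using assms by (simp add: omega_def)
qed

lemma omega_mono:
  assumes "0 \<le> \<alpha>" "0 \<le> \<beta>" "1 < t0" "0 \<le> s" "s \<le> t" "t \<le> 1"
  shows "omega \<alpha> \<beta> t0 s \<le> omega \<alpha> \<beta> t0 t"
proof (cases "s = 0")
  case True
  then show ?thesis using omega_pos[of t0 t \<alpha> \<beta>] assms by (cases "t = 0") (auto simp: omega_def)
next
  case False
  then have s: "0 < s" "0 < t" using assms by auto
  have "ln t \<le> 0" "0 < ln t0" "ln s \<le> ln t" using assms s by auto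
  then have "s powr \<alpha> * (ln t0 - ln s) powr - \<beta> \<le> t powr \<alpha> * (ln t0 - ln t) powr - \<beta>"
    using assms s by (intro mult_mono powr_mono2 powr_mono2') auto
  then show ?thesis using s by (simp add: omega_def)
qed

lemma omega_small:
  assumes "0 \<le> \<alpha>" "0 \<le> \<beta>" "(\<alpha>, \<beta>) \<noteq> (0, 0)" "1 < t0" "0 < e"
  obtains \<delta> where "0 < \<delta>" "\<And>t. 0 \<le> t \<Longrightarrow> t < \<delta> \<Longrightarrow> omega \<alpha> \<beta> t0 t < e"
proof -
  have "((\<lambda>t. t powr \<alpha> * (ln t0 - ln t) powr - \<beta>) \<longlongrightarrow> 0) (at_right 0)"
  proof (cases "\<alpha> = 0")
    case True
    then have "0 < \<beta>" using assms by auto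
    have "filterlim (\<lambda>t::real. ln t0 + - ln t) at_top (at_right 0)"
      using ln_at_0 by (intro filterlim_tendsto_add_at_top[OF tendsto_const])
        (simp add: filterlim_uminus_at_top)
    then have "((\<lambda>t. (ln t0 + - ln t) powr - \<beta>) \<longlongrightarrow> 0) (at_right 0)"
      using \<open>0 < \<beta>\<close> by (intro tendsto_neg_powr) auto
    then show ?thesis
      by (rule Lim_transform_eventually)
        (rule eventually_mono[OF eventually_at_right_less], simp add: True)
  next
    case False
    then have "((\<lambda>t::real. t powr \<alpha>) \<longlongrightarrow> 0) (at_right 0)"
      using assms eventually_mono[OF eventually_at_right_less[of "0::real"]]
      by (intro tendsto_zero_powrI[where b = \<alpha>] tendsto_const tendsto_ident_at) auto
    then have lim: "((\<lambda>t::real. t powr \<alpha> * ln t0 powr - \<beta>) \<longlongrightarrow> 0) (at_right 0)"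
      by (rule tendsto_mult_left_zero)
    have "eventually (\<lambda>t::real. t \<in> {0<..<1}) (at_right 0)"
      by (rule eventually_at_rightI[of 0 1]) auto
    then have "eventually (\<lambda>t. norm (t powr \<alpha> * (ln t0 - ln t) powr - \<beta>) \<le> t powr \<alpha> * ln t0 powr - \<beta>) (at_right 0)"
    proof (rule eventually_mono)
      fix t :: real assume "t \<in> {0<..<1}"
      then have "ln t0 \<le> ln t0 - ln t" by simp
      then have "(ln t0 - ln t) powr - \<beta> \<le> ln t0 powr - \<beta>" using assms by (intro powr_mono2') auto
      then show "norm (t powr \<alpha> * (ln t0 - ln t) powr - \<beta>) \<le> t powr \<alpha> * ln t0 powr - \<beta>"
        by (auto intro: mult_left_mono)
    qed
    from Lim_null_comparison[OF this lim] show ?thesis .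
  qed
  then have "eventually (\<lambda>t. t powr \<alpha> * (ln t0 - ln t) powr - \<beta> < e) (at_right 0)"
    using assms(5) by (rule order_tendstoD)
  then obtain \<delta> where "0 < \<delta>" "\<And>t. 0 < t \<Longrightarrow> t < \<delta> \<Longrightarrow> t powr \<alpha> * (ln t0 - ln t) powr - \<beta> < e"
    unfolding eventually_at_right_field by auto
  then show thesis using assms(5) by (intro that[of \<delta>]) (auto simp: omega_def)
qed

lemma is_modulus_props:
  assumes "is_modulus \<alpha> \<beta> w"
  shows "w 0 = 0" "\<And>t. 0 < t \<Longrightarrow> t \<le> 1 \<Longrightarrow> 0 < w t"
    "\<And>s t. 0 \<le> s \<Longrightarrow> s \<le> t \<Longrightarrow> t \<le> 1 \<Longrightarrow> w s \<le> w t"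
    "\<And>e. 0 < e \<Longrightarrow> \<exists>\<delta>>0. \<forall>t. 0 \<le> t \<longrightarrow> t < \<delta> \<longrightarrow> w t < e"
proof -
  obtain t0 where t0: "1 < t0" "w = omega \<alpha> \<beta> t0" and ab: "0 \<le> \<alpha>" "0 \<le> \<beta>" "(\<alpha>, \<beta>) \<noteq> (0, 0)"
    using assms unfolding is_modulus_def by blast
  show "w 0 = 0" by (simp add: t0 omega_def)
  show "0 < w t" if "0 < t" "t \<le> 1" for t using omega_pos t0 that by simp
  show "w s \<le> w t" if "0 \<le> s" "s \<le> t" "t \<le> 1" for s t using omega_mono ab t0 that by simp
  show "\<exists>\<delta>>0. \<forall>t. 0 \<le> t \<longrightarrow> t < \<delta> \<longrightarrow> w t < e" if "0 < e" for e
    using omega_small[OF ab t0(1) that] unfolding t0(2) by metis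
qed

lemma continuous_on_of_holder_with:
  assumes w: "is_modulus \<alpha> \<beta> w" and f: "holder_with w C f"
  shows "continuous_on UNIV f"
proof (subst continuous_on_iff, intro ballI allI impI)
  fix x and e :: real assume "0 < e"
  define C' where "C' = max C 1"
  from is_modulus_props(4)[OF w, of "e / C'"] \<open>0 < e\<close> obtain \<delta> where
    \<delta>: "0 < \<delta>" "\<forall>t. 0 \<le> t \<longrightarrow> t < \<delta> \<longrightarrow> w t < e / C'" by (auto simp: C'_def)
  show "\<exists>d>0. \<forall>x'\<in>UNIV. dist x' x < d \<longrightarrow> dist (f x') (f x) < e"
  proof (intro exI[of _ "min \<delta> 1"] conjI ballI impI)
    fix y assume y: "dist y x < min \<delta> 1"
    have w0: "0 \<le> w (dist y x)" using is_modulus_props(3)[OF w, of 0 "dist y x"] is_modulus_props(1)[OF w] y by simp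
    have "\<bar>f y - f x\<bar> \<le> C * w (dist y x)" using f by (simp add: holder_with_def)
    also have "\<dots> \<le> C' * w (dist y x)" using w0 by (intro mult_right_mono) (auto simp: C'_def)
    also have "\<dots> < C' * (e / C')" using \<delta> y by (intro mult_strict_left_mono) (auto simp: C'_def)
    finally show "dist (f y) (f x) < e" by (simp add: C'_def dist_real_def)
  qed (use \<delta> in auto)
qed

section \<open>Decay of the moduli along the contraction functions\<close>

lemma omega_log_decay:
  assumes "0 < \<beta>" "1 < t0" "0 < s" "s < 1" "1 \<le> C"
  obtains B where "0 \<le> B"
    "\<And>j u. 1 \<le> j \<Longrightarrow> 0 \<le> u \<Longrightarrow> u \<le> 1 \<Longrightarrow> u \<le> C * s ^ j \<Longrightarrow> omega 0 \<beta> t0 u \<le> B * real j powr - \<beta>"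
proof -
  \<comment> \<open>From \<open>u \<le> C * s ^ j\<close> one gets
    \<open>- ln u \<ge> j * - ln s - ln C\<close>, but \<open>ln C\<close> may exceed
    \<open>ln t0\<close>. As \<open>ln u \<le> 0\<close>, it is enough to use the fraction \<theta>
    of \<open>- ln u\<close>, with \<theta> so small that
    \<open>\<theta> * ln C \<le> ln t0\<close>. The \<open>+ 1\<close> guards the case
    \<open>C = 1\<close>.\<close>
  define \<theta> where "\<theta> = min 1 (ln t0 / (ln C + 1))"
  have l: "0 < ln t0" "0 \<le> ln C" "ln s < 0" using assms by auto
  have \<theta>: "0 < \<theta>" "\<theta> \<le> 1" using l by (auto simp: \<theta>_def)
  have "\<theta> \<le> ln t0 / (ln C + 1)" by (simp add: \<theta>_def)
  then have "\<theta> * (ln C + 1) \<le> ln t0" using l by (simp add: pos_le_divide_eq)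
  then have \<theta>C: "\<theta> * ln C \<le> ln t0" using \<theta> by (simp add: distrib_left)
  show thesis
  proof (rule that[of "(\<theta> * - ln s) powr - \<beta>"])
    fix j :: nat and u :: real assume j: "1 \<le> j" and u: "0 \<le> u" "u \<le> 1" "u \<le> C * s ^ j"
    show "omega 0 \<beta> t0 u \<le> (\<theta> * - ln s) powr - \<beta> * real j powr - \<beta>"
    proof (cases "u = 0")
      case False
      then have u0: "0 < u" using u by simp
      have "ln u \<le> ln (C * s ^ j)" using u u0 by simp
      also have "\<dots> = ln C + j * ln s" using assms by (simp add: ln_mult ln_realpow)
      finally have "\<theta> * ln u \<le> \<theta> * (ln C + j * ln s)" using \<theta> by (intro mult_left_mono) auto
      moreover have "1 * ln u \<le> \<theta> * ln u" using u0 u \<theta> by (intro mult_right_mono_neg) auto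
      ultimately have "\<theta> * - ln s * j \<le> ln t0 - ln u" using \<theta>C unfolding distrib_left
        by (simp add: mult.assoc[symmetric] mult.commute[of "real j"])
      moreover have "0 < \<theta> * - ln s" using \<theta> l by (simp add: mult_pos_neg)
      ultimately have "(ln t0 - ln u) powr - \<beta> \<le> (\<theta> * - ln s * j) powr - \<beta>"
        using assms j mult_pos_pos[OF \<open>0 < \<theta> * - ln s\<close>, of "real j"] by (intro powr_mono2') auto
      then show ?thesis using u0 \<open>0 < \<theta> * - ln s\<close> by (simp add: omega_def powr_mult[symmetric])
    qed (simp add: omega_def)
  qed auto
qed

lemma omega_power_decay:
  assumes "0 < \<alpha>" "1 < t0" "0 \<le> C" "1 \<le> j" "0 \<le> u" "u \<le> 1" "u \<le> C * real j powr - \<beta>"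
  shows "omega \<alpha> 0 t0 u \<le> C powr \<alpha> * real j powr - (\<alpha> * \<beta>)"
proof (cases "u = 0")
  case False
  \<comment> \<open>The base \<open>ln t0 - ln u\<close> is positive; this matters because
    \<open>x powr 0\<close> is 1 only for nonzero \<open>x\<close>.\<close>
  have "ln u \<le> 0" "0 < ln t0" using assms False by auto
  have "u powr \<alpha> \<le> (C * real j powr - \<beta>) powr \<alpha>" using assms by (intro powr_mono2) auto
  also have "\<dots> = C powr \<alpha> * real j powr - (\<alpha> * \<beta>)"
    using assms by (simp add: powr_mult powr_powr mult.commute)
  finally show ?thesis using False \<open>ln u \<le> 0\<close> \<open>0 < ln t0\<close> by (simp add: omega_def)
qed (simp add: omega_def)

text \<open>Common form of both settings. The variable \<open>u\<close> ranges below
  \<open>c j t\<close> within [0,1] because \<open>c j t\<close> itself may exceed 1, where the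
  moduli are not controlled. The bound on \<open>c 1\<close> serves the continuity of the transfer
  operator.\<close>

definition polynomial_decay ::
    "(nat \<Rightarrow> real \<Rightarrow> real) \<Rightarrow> (real \<Rightarrow> real) \<Rightarrow> real \<Rightarrow> (real \<Rightarrow> real) \<Rightarrow> bool" where
  "polynomial_decay c w \<gamma> wd \<longleftrightarrow>
     0 < \<gamma> \<and> (\<exists>\<alpha> \<beta>. is_modulus \<alpha> \<beta> w) \<and> (\<exists>\<alpha> \<beta>. is_modulus \<alpha> \<beta> wd) \<and>
     (\<exists>L\<ge>0. \<forall>t\<in>{0..1}. c 1 t \<le> L * t) \<and>
     (\<exists>B\<ge>0. \<forall>j\<ge>1. \<forall>t\<in>{0..1}. \<forall>u\<in>{0..1}. u \<le> c j t \<longrightarrow>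
        w u \<le> B * real j powr - (\<gamma> + 1) \<and> wd u \<le> B * real j powr - \<gamma>)"

lemma setting_I_decay:
  assumes "setting_I c w \<gamma> wd"
  shows "polynomial_decay c w \<gamma> wd"
proof -
  obtain \<beta> s C where \<beta>: "1 < \<beta>" "0 < s" "s < 1" and c: "\<forall>n. \<forall>t\<in>{0..1}. c n t \<le> C * (s ^ n * t)"
    and w: "is_modulus 0 \<beta> w" "\<gamma> = \<beta> - 1" "is_modulus 0 (\<beta> - 1) wd"
    using assms unfolding setting_I_def by auto
  define C' where "C' = max C 1"
  have c': "c n t \<le> C' * (s ^ n * t)" if "t \<in> {0..1}" for n t
  proof -
    have "C * (s ^ n * t) \<le> C' * (s ^ n * t)" using that \<beta> by (intro mult_right_mono) (auto simp: C'_def)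
    with c[rule_format, OF that, of n] show ?thesis by (rule order_trans)
  qed
  obtain t0 where t0: "1 < t0" "w = omega 0 \<beta> t0" using w unfolding is_modulus_def by blast
  obtain t1 where t1: "1 < t1" "wd = omega 0 \<gamma> t1" using w unfolding is_modulus_def by blast
  have C': "1 \<le> C'" by (simp add: C'_def)
  obtain B0 where B0: "0 \<le> B0" "\<And>j u. 1 \<le> j \<Longrightarrow> 0 \<le> u \<Longrightarrow> u \<le> 1 \<Longrightarrow> u \<le> C' * s ^ j \<Longrightarrow>
      omega 0 \<beta> t0 u \<le> B0 * real j powr - \<beta>"
    using omega_log_decay[of \<beta> t0 s C'] \<beta> t0 C' by auto
  obtain B1 where B1: "0 \<le> B1" "\<And>j u. 1 \<le> j \<Longrightarrow> 0 \<le> u \<Longrightarrow> u \<le> 1 \<Longrightarrow> u \<le> C' * s ^ j \<Longrightarrow>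
      omega 0 \<gamma> t1 u \<le> B1 * real j powr - \<gamma>"
    using omega_log_decay[of \<gamma> t1 s C'] \<beta> w t1 C' by auto
  have "w u \<le> (B0 + B1) * real j powr - (\<gamma> + 1) \<and> wd u \<le> (B0 + B1) * real j powr - \<gamma>"
    if "1 \<le> j" "t \<in> {0..1}" "u \<in> {0..1}" "u \<le> c j t" for j t u
  proof -
    have "u \<le> C' * (s ^ j * t)" using c'[OF that(2), of j] that by simp
    also have "\<dots> \<le> C' * (s ^ j * 1)" using \<beta> that C' by (intro mult_left_mono) auto
    finally have "u \<le> C' * s ^ j" by simp
    from B0(2)[OF that(1) _ _ this] B1(2)[OF that(1) _ _ this]
    show ?thesis using that B0(1) B1(1) w by (auto simp: t0 t1 distrib_right intro: add_increasing add_increasing2)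
  qed
  moreover have "\<forall>t\<in>{0..1}. c 1 t \<le> (C' * s) * t" using c'[of _ 1] by (simp add: mult_ac)
  moreover have "0 \<le> C' * s" using C' \<beta> by simp
  moreover have "0 \<le> B0 + B1" using B0 B1 by simp
  ultimately show ?thesis using w \<beta> unfolding polynomial_decay_def by (intro conjI) (blast | simp)+
qed

lemma setting_II_decay:
  assumes "setting_II c w \<gamma> wd"
  shows "polynomial_decay c w \<gamma> wd"
proof -
  obtain \<alpha> \<beta> C where \<beta>: "1 < \<beta>" "1 < \<alpha> * \<beta>"
    and c: "\<forall>n. \<forall>t\<in>{0..1}. c n t \<le> C * (t * (1 + real n * t powr (1 / \<beta>)) powr - \<beta>)"
    and w: "is_modulus \<alpha> 0 w" "\<gamma> = \<alpha> * \<beta> - 1" "is_modulus (\<alpha> - 1 / \<beta>) 0 wd"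
    using assms unfolding setting_II_def by auto
  define C' where "C' = max C 1"
  have C': "1 \<le> C'" by (simp add: C'_def)
  have c': "c n t \<le> C' * (t * (1 + real n * t powr (1 / \<beta>)) powr - \<beta>)" if "t \<in> {0..1}" for n t
  proof -
    have "C * (t * (1 + real n * t powr (1 / \<beta>)) powr - \<beta>)
        \<le> C' * (t * (1 + real n * t powr (1 / \<beta>)) powr - \<beta>)"
      using that by (intro mult_right_mono) (auto simp: C'_def)
    with c[rule_format, OF that, of n] show ?thesis by (rule order_trans)
  qed
  obtain t0 where t0: "1 < t0" "w = omega \<alpha> 0 t0" using w unfolding is_modulus_def by blast
  obtain t1 where t1: "1 < t1" "wd = omega (\<alpha> - 1 / \<beta>) 0 t1" using w unfolding is_modulus_def by blast
  have \<alpha>: "0 < \<alpha>" "0 < \<alpha> - 1 / \<beta>" 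
  proof -
    have "0 < \<alpha> * \<beta>" using \<beta> by linarith
    then show "0 < \<alpha>" using \<beta> by (simp add: zero_less_mult_iff)
    show "0 < \<alpha> - 1 / \<beta>" using \<beta> by (simp add: field_simps)
  qed
  define B where "B = C' powr \<alpha> + C' powr (\<alpha> - 1 / \<beta>)"
  have "w u \<le> B * real j powr - (\<gamma> + 1) \<and> wd u \<le> B * real j powr - \<gamma>"
    if "1 \<le> j" "t \<in> {0..1}" "u \<in> {0..1}" "u \<le> c j t" for j t u
  proof -
    \<comment> \<open>Uniform in \<open>t\<close>: once the summand 1 is dropped,
      \<open>t powr (1 / \<beta>)\<close> to the power \<open>- \<beta>\<close> cancels the factor
      \<open>t\<close>. The powers \<alpha> and \<open>\<alpha> - 1 / \<beta>\<close> of
      \<open>j powr - \<beta>\<close> then have exactly the exponents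
      \<open>- (\<gamma> + 1)\<close> and \<open>- \<gamma>\<close>.\<close>
    have "t * (1 + real j * t powr (1 / \<beta>)) powr - \<beta> \<le> real j powr - \<beta>"
    proof (cases "t = 0")
      case False
      then have t: "0 < t" using that by simp
      have "(1 + real j * t powr (1 / \<beta>)) powr - \<beta> \<le> (real j * t powr (1 / \<beta>)) powr - \<beta>"
        using \<beta> t that by (intro powr_mono2') auto
      also have "\<dots> = real j powr - \<beta> * t powr - 1"
        using \<beta> by (simp add: powr_mult powr_powr)
      finally have "t * (1 + real j * t powr (1 / \<beta>)) powr - \<beta> \<le> t * (real j powr - \<beta> * t powr - 1)"
        using t by (intro mult_left_mono) auto
      also have "\<dots> = real j powr - \<beta>" using t by (simp add: powr_minus_divide)
      finally show ?thesis .
    qed simp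
    then have "C' * (t * (1 + real j * t powr (1 / \<beta>)) powr - \<beta>) \<le> C' * real j powr - \<beta>"
      using C' by (intro mult_left_mono) auto
    then have u: "u \<le> C' * real j powr - \<beta>" using c'[OF that(2), of j] that by simp
    have "w u \<le> C' powr \<alpha> * real j powr - (\<alpha> * \<beta>)"
      unfolding t0 using \<alpha> t0 C' that u by (intro omega_power_decay) auto
    moreover have "wd u \<le> C' powr (\<alpha> - 1 / \<beta>) * real j powr - ((\<alpha> - 1 / \<beta>) * \<beta>)"
      unfolding t1 using \<alpha> t1 C' that u by (intro omega_power_decay) auto
    moreover have "(\<alpha> - 1 / \<beta>) * \<beta> = \<gamma>" using w \<beta> by (simp add: left_diff_distrib)
    ultimately show ?thesis
      using w by (auto simp: B_def distrib_right intro: add_increasing add_increasing2)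
  qed
  moreover have "c 1 t \<le> C' * t" if t: "t \<in> {0..1}" for t
  proof -
    have "(1 + real 1 * t powr (1 / \<beta>)) powr - \<beta> \<le> 1 powr - \<beta>"
      using \<beta> t by (intro powr_mono2') auto
    then have "C' * (t * (1 + real 1 * t powr (1 / \<beta>)) powr - \<beta>) \<le> C' * (t * 1)"
      using C' t by (intro mult_left_mono) auto
    then show ?thesis using c'[OF t, of 1] by simp
  qed
  moreover have "0 \<le> B" "0 \<le> C'" using C' by (auto simp: B_def)
  ultimately show ?thesis using w \<beta> unfolding polynomial_decay_def by (intro conjI) (blast | simp)+
qed

section \<open>Bounded fibres and a uniform hitting time\<close>

lemma fibre_card_bounded:
  fixes T :: "'a::topological_space \<Rightarrow> 'b::topological_space"
  assumes "compact (UNIV :: 'a set)" "local_homeomorphism T"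
  obtains D :: nat where "\<And>x. finite {y. T y = x}" "\<And>x. card {y. T y = x} \<le> D"
proof -
  \<comment> \<open>Sets on which \<open>T\<close> is injective meet each fibre in at most one
    point, so the size of a finite subcover by such sets serves as \<open>D\<close>.\<close>
  have "\<forall>x. \<exists>U. open U \<and> x \<in> U \<and> inj_on T U"
  proof
    fix x
    obtain U S where "open U" "x \<in> U" "homeomorphism U (T ` U) T S"
      using assms(2) unfolding local_homeomorphism_def by blast
    then show "\<exists>U. open U \<and> x \<in> U \<and> inj_on T U"
      unfolding homeomorphism_def by (intro exI[of _ U]) (auto intro!: inj_on_inverseI)
  qed
  then obtain U where U: "\<And>x. open (U x)" "\<And>x. x \<in> U x" "\<And>x. inj_on T (U x)" by metis
  obtain X where X: "finite X" "UNIV \<subseteq> (\<Union>x\<in>X. U x)"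
    by (rule compactE_image[OF assms(1), of UNIV U]) (use U in auto)
  have fib: "{y. T y = z} = (\<Union>x\<in>X. {y \<in> U x. T y = z})" for z using X by auto
  have one: "finite {y \<in> U x. T y = z} \<and> card {y \<in> U x. T y = z} \<le> 1" for x z
  proof (cases "{y \<in> U x. T y = z} = {}")
    case True
    then show ?thesis by (simp only: finite.emptyI card.empty) simp
  next
    case False
    then obtain y where "y \<in> U x" "T y = z" by auto
    then have "{y \<in> U x. T y = z} = {y}" using U(3)[of x] by (auto simp: inj_on_def)
    then show ?thesis by simp
  qed
  show thesis
  proof (rule that[of "card X"])
    show "finite {y. T y = z}" for z unfolding fib using X one by blast
    fix z
    have "card {y. T y = z} \<le> (\<Sum>x\<in>X. card {y \<in> U x. T y = z})"
      unfolding fib by (rule card_UN_le[OF X(1)])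
    also have "\<dots> \<le> card X"
      using sum_bounded_above[of X "\<lambda>x. card {y \<in> U x. T y = z}" 1] one by simp
    finally show "card {y. T y = z} \<le> card X" .
  qed
qed

text \<open>Mixing lets \<open>T\<^sup>N\<close> of any small ball meet any other one; expansivity then corrects the
  endpoint, at a cost of \<open>c N 1\<close>.\<close>

lemma uniform_hitting_time:
  fixes T :: "'a::metric_space \<Rightarrow> 'a"
  assumes cpt: "compact (UNIV :: 'a set)" and dist1: "\<And>x y :: 'a. dist x y \<le> 1" and r: "0 < r"
    and c: "contraction_family c" and exp: "ruelle_expansive c r T" and mix: "topologically_mixing T"
  obtains N where "1 \<le> N" "\<And>x z. \<exists>y. (T ^^ N) y = x \<and> dist y z < r"
proof -
  \<comment> \<open>Three errors \<open>e\<close> must stay below \<open>r\<close>: one from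
    expansivity and two from the ball around \<open>q\<close>. The end point is corrected by less
    than \<open>2 * e\<close>.\<close>
  define e where "e = r / 4"
  have e: "0 < e" using r by (simp add: e_def)
  obtain X :: "'a set" where X: "finite X" "UNIV \<subseteq> (\<Union>x\<in>X. ball x e)"
    by (rule compactE_image[OF cpt, of UNIV "\<lambda>x. ball x e"]) (use e in auto)
  have mix': "\<exists>k. \<forall>n>k. ((T ^^ n) -` U) \<inter> V \<noteq> {}" if "open U" "U \<noteq> {}" "open V" "V \<noteq> {}" for U V
    using mix that unfolding topologically_mixing_def by blast
  have "\<forall>p. \<exists>k. \<forall>n>k. ((T ^^ n) -` ball (fst p) e) \<inter> ball (snd p) e \<noteq> {}"
    by (intro allI mix') (use e in simp_all)
  from choice[OF this] obtain k where
    k: "\<forall>p. \<forall>n>k p. ((T ^^ n) -` ball (fst p) e) \<inter> ball (snd p) e \<noteq> {}" by blast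
  have "(\<lambda>n. c n 1) \<longlonglongrightarrow> 0" using c by (auto simp: contraction_family_def)
  then have "eventually (\<lambda>n. c n 1 < e) sequentially" using e by (rule order_tendstoD)
  then obtain n0 where n0: "\<And>n. n0 \<le> n \<Longrightarrow> c n 1 < e" unfolding eventually_sequentially by blast
  \<comment> \<open>Only finitely many pairs of centres occur, so one \<open>N\<close> exceeds all
    their mixing times; it also makes \<open>c N 1 < e\<close>.\<close>
  define N where "N = Suc (Max (insert n0 (k ` (X \<times> X))))"
  have fin: "finite (insert n0 (k ` (X \<times> X)))" using X by simp
  have N: "n0 \<le> N" "k p < N" if "p \<in> X \<times> X" for p
  proof -
    show "n0 \<le> N" unfolding N_def by (intro le_SucI Max_ge[OF fin]) simp
    show "k p < N" unfolding N_def less_Suc_eq_le by (rule Max_ge[OF fin]) (use that in blast)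
  qed
  show thesis
  proof (rule that[of N])
    show "1 \<le> N" by (simp add: N_def)
    fix x z
    obtain p q where pq: "p \<in> X" "x \<in> ball p e" "q \<in> X" "z \<in> ball q e" using X by blast
    have kN: "k (p, q) < N" and n0N: "n0 \<le> N" using N[of "(p, q)"] pq by simp_all
    have "((T ^^ N) -` ball (fst (p, q)) e) \<inter> ball (snd (p, q)) e \<noteq> {}"
      using k kN by blast
    then obtain v where v: "(T ^^ N) v \<in> ball p e" "v \<in> ball q e"
      by auto
    have "dist ((T ^^ N) v) x < 2 * e"
      using v(1) pq(2) dist_triangle3[of "(T ^^ N) v" x p] by simp
    then have close: "dist ((T ^^ N) v) x < r" using e by (simp add: e_def)
    then obtain y where y: "(T ^^ N) y = x"
      "\<forall>i\<le>N. dist ((T ^^ i) v) ((T ^^ i) y) \<le> c (N - i) (dist ((T ^^ N) v) x)"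
      using exp[unfolded ruelle_expansive_def, rule_format, OF \<open>1 \<le> N\<close>, of "(T ^^ N) v" x v] by blast
    have "strict_mono_on {0..1} (c N)" using c by (simp add: contraction_family_def)
    from monotone_onD[OF strict_mono_on_imp_mono_on[OF this], of "dist ((T ^^ N) v) x" 1]
    have "c N (dist ((T ^^ N) v) x) \<le> c N 1" using dist1 by simp
    moreover have "dist v y \<le> c N (dist ((T ^^ N) v) x)" using y(2)[rule_format, of 0] by simp
    moreover have "c N 1 < e" using n0 n0N by blast
    ultimately have "dist v y < e" by linarith
    moreover have "dist y z \<le> dist v y + (dist q v + dist q z)"
      using dist_triangle3[of y z v] dist_triangle3[of v z q] dist_commute[of v y] by linarith
    ultimately have "dist y z < r" using v(2) pq(4) e by (simp add: e_def)
    with y(1) show "\<exists>y. (T ^^ N) y = x \<and> dist y z < r" by blast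
  qed
qed

section \<open>Conformality\<close>

text \<open>\<open>hol_const\<close> sees only distances below \<open>r\<close>; beyond, the sup
  norm takes over at the cost of \<open>2 / w (min r 1)\<close>, where \<open>min r 1\<close> keeps
  the argument in the range on which \<open>w\<close> is positive. The Hoelder condition with
  \<open>C\<close> makes both suprema finite.\<close>

lemma holder_norm_bounds:
  fixes f :: "'a::metric_space \<Rightarrow> real"
  assumes dist1: "\<And>x y :: 'a. dist x y \<le> 1" and r: "0 < r"
    and w: "is_modulus \<alpha> \<beta> w" and f: "holder_with w C f"
  shows "\<bar>f x\<bar> \<le> holder_norm r w f"
    and "\<bar>f x - f y\<bar> \<le> max 1 (2 / w (min r 1)) * holder_norm r w f * w (dist x y)"
proof -
  note w0 = is_modulus_props(1)[OF w] and wpos = is_modulus_props(2)[OF w]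
    and wmono = is_modulus_props(3)[OF w]
  have w_nonneg: "0 \<le> w (dist u v)" for u v :: 'a
    using wmono[of 0 "dist u v"] w0 dist1 by simp
  have fC: "\<bar>f u - f v\<bar> \<le> C * w (dist u v)" for u v using f by (simp add: holder_with_def)
  have "bdd_above (range (\<lambda>u. \<bar>f u\<bar>))"
  proof (rule bdd_aboveI2)
    fix u
    have "\<bar>f u - f x\<bar> \<le> \<bar>C\<bar> * w (dist u x)"
      by (rule order_trans[OF fC mult_right_mono[OF abs_ge_self w_nonneg]])
    also have "\<dots> \<le> \<bar>C\<bar> * w 1" using wmono dist1 by (intro mult_left_mono) auto
    finally show "\<bar>f u\<bar> \<le> \<bar>f x\<bar> + \<bar>C\<bar> * w 1" by linarith
  qed
  then have sup: "\<bar>f u\<bar> \<le> sup_norm f" for u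
    unfolding sup_norm_def by (intro cSUP_upper) auto
  let ?S = "{\<bar>f u - f v\<bar> / w (dist u v) | u v. 0 < dist u v \<and> dist u v < r}"
  have "bdd_above ?S"
  proof (rule bdd_aboveI)
    fix q assume "q \<in> ?S"
    then obtain u v where "q = \<bar>f u - f v\<bar> / w (dist u v)" "0 < dist u v" by blast
    then show "q \<le> C" using fC[of u v] wpos[of "dist u v"] dist1 by (simp add: pos_divide_le_eq)
  qed
  then have bdd: "bdd_above (insert 0 ?S)" by simp
  have hol0: "0 \<le> hol_const r w f" unfolding hol_const_def by (rule cSup_upper[OF _ bdd]) simp
  have hol: "\<bar>f u - f v\<bar> \<le> hol_const r w f * w (dist u v)" if "0 < dist u v" "dist u v < r" for u v
  proof -
    have "\<bar>f u - f v\<bar> / w (dist u v) \<le> hol_const r w f"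
      unfolding hol_const_def by (rule cSup_upper[OF _ bdd]) (use that in blast)
    then show ?thesis using wpos[OF that(1) dist1] by (simp add: pos_divide_le_eq)
  qed
  have sup0: "0 \<le> sup_norm f" using sup[of x] by linarith
  show "\<bar>f x\<bar> \<le> holder_norm r w f" using sup[of x] hol0 by (simp add: holder_norm_def)
  define H where "H = max 1 (2 / w (min r 1))"
  have H1: "1 \<le> H" by (simp add: H_def)
  have n0: "0 \<le> holder_norm r w f" using sup0 hol0 by (simp add: holder_norm_def)
  have "\<bar>f x - f y\<bar> \<le> H * holder_norm r w f * w (dist x y)"
  proof (cases "0 < dist x y \<and> dist x y < r")
    case True
    then have "\<bar>f x - f y\<bar> \<le> hol_const r w f * w (dist x y)" by (intro hol) auto
    also have "\<dots> \<le> H * holder_norm r w f * w (dist x y)"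
    proof (rule mult_right_mono[OF _ w_nonneg])
      have "hol_const r w f \<le> 1 * holder_norm r w f" using sup0 by (simp add: holder_norm_def)
      also have "\<dots> \<le> H * holder_norm r w f" using H1 n0 by (rule mult_right_mono)
      finally show "hol_const r w f \<le> H * holder_norm r w f" .
    qed
    finally show ?thesis .
  next
    case False
    show ?thesis
    proof (cases "x = y")
      case True
      then show ?thesis by (simp add: w0)
    next
      case ne: False
      then have d: "r \<le> dist x y" using False by simp
      then have "min r 1 = r" using dist1[of x y] by simp
      have "0 < w r" using r d dist1[of x y] by (intro wpos) auto
      have "w r \<le> w (dist x y)" using r d dist1 by (intro wmono) auto
      have "\<bar>f x - f y\<bar> \<le> 2 * holder_norm r w f"
        using sup[of x] sup[of y] hol0 by (simp add: holder_norm_def)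
      also have "\<dots> = 2 / w r * holder_norm r w f * w r" using \<open>0 < w r\<close> by simp
      also have "\<dots> \<le> H * holder_norm r w f * w (dist x y)"
        using \<open>0 < w r\<close> \<open>w r \<le> w (dist x y)\<close> n0 H1 \<open>min r 1 = r\<close>
        by (intro mult_mono) (auto simp: H_def)
      finally show ?thesis .
    qed
  qed
  then show "\<bar>f x - f y\<bar> \<le> max 1 (2 / w (min r 1)) * holder_norm r w f * w (dist x y)"
    by (simp add: H_def)
qed

context ruelle_system
begin

text \<open>Fibres of nearby points are paired at order 1, \<open>c 1\<close> bounds the distance
  within a pair, and uniform continuity of the summand does the rest. Continuity matters because the
  invariance of \<mu> is tested on continuous functions.\<close>

lemma continuous_on_transfer_op:
  fixes a f :: "'a \<Rightarrow> real"
  assumes cpt: "compact (UNIV :: 'a set)" and r: "0 < r"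
    and L: "0 \<le> L" "\<And>t. t \<in> {0..1} \<Longrightarrow> c 1 t \<le> L * t"
    and cont: "continuous_on UNIV a" "continuous_on UNIV f"
  shows "continuous_on UNIV (transfer_op T a f)"
proof (subst continuous_on_iff, intro ballI allI impI)
  fix x and e :: real assume e: "0 < e"
  define F where "F y = exp (a y) * f y" for y
  define e' where "e' = e / (real D + 1)"
  have e': "0 < e'" "real D * e' < e" using e by (auto simp: e'_def field_simps)
  have "continuous_on UNIV F" unfolding F_def by (intro continuous_intros cont)
  then have "uniformly_continuous_on UNIV F" using cpt by (rule compact_uniformly_continuous)
  then obtain \<delta> where \<delta>: "0 < \<delta>" "\<And>y z. dist z y < \<delta> \<Longrightarrow> dist (F z) (F y) < e'"
    using e'(1) unfolding uniformly_continuous_on_def by blast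
  have L1: "0 < L + 1" using L by simp
  show "\<exists>d>0. \<forall>y\<in>UNIV. dist y x < d \<longrightarrow> dist (transfer_op T a f y) (transfer_op T a f x) < e"
  proof (intro exI[of _ "min r (\<delta> / (L + 1))"] conjI ballI impI)
    show "0 < min r (\<delta> / (L + 1))" using r \<delta> L1 by simp
    fix y assume y: "dist y x < min r (\<delta> / (L + 1))"
    then have "dist y x < r" by simp
    from pairing[OF order_refl this] obtain \<phi> where
      \<phi>: "bij_betw \<phi> {z. (T ^^ 1) z = y} {z. (T ^^ 1) z = x}"
      "\<And>z. (T ^^ 1) z = y \<Longrightarrow> shadows 1 (dist y x) z (\<phi> z)" by blast
    have close: "\<bar>F z - F (\<phi> z)\<bar> \<le> e'" if "T z = y" for z
    proof -
      have "dist z (\<phi> z) \<le> c 1 (dist y x)"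
        using \<phi>(2)[of z] that unfolding shadows_def by force
      also have "\<dots> \<le> L * dist y x" using dist_le_1 by (intro L) auto
      also have "\<dots> \<le> (L + 1) * dist y x" by (intro mult_right_mono) auto
      also have "\<dots> < \<delta>" using y L1 by (simp add: pos_less_divide_eq mult.commute)
      finally show ?thesis using \<delta>(2) by (simp add: dist_real_def less_imp_le)
    qed
    have "transfer_op T a f x = (\<Sum>z | T z = y. F (\<phi> z))"
      using sum.reindex_bij_betw[OF \<phi>(1), of F] by (simp add: transfer_op_def F_def)
    then have "\<bar>transfer_op T a f y - transfer_op T a f x\<bar> = \<bar>\<Sum>z | T z = y. F z - F (\<phi> z)\<bar>"
      by (simp add: transfer_op_def F_def sum_subtractf)
    also have "\<dots> \<le> (\<Sum>z | T z = y. \<bar>F z - F (\<phi> z)\<bar>)" by (rule sum_abs)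
    also have "\<dots> \<le> card {z. T z = y} * e'" using close by (intro sum_bounded_above) auto
    also have "\<dots> \<le> D * e'" using card_fibre e' by (intro mult_right_mono) auto
    finally show "dist (transfer_op T a f y) (transfer_op T a f x) < e"
      using e' by (simp add: dist_real_def)
  qed
qed

text \<open>By conformality, \<open>m\<^sub>a(f)\<close> is the average of \<open>L\<^sup>n f / L\<^sup>n 1\<close> for the probability measure
  \<open>\<rho> powr - n \<cdot> L\<^sup>n 1 dm\<^sub>a\<close>.\<close>

lemma conformal_average_bounds:
  fixes a f :: "'a \<Rightarrow> real"
  assumes cpt: "compact (UNIV :: 'a set)" and r: "0 < r"
    and L: "0 \<le> L" "\<And>t. t \<in> {0..1} \<Longrightarrow> c 1 t \<le> L * t"
    and a: "continuous_on UNIV a" and f: "continuous_on UNIV f"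
    and wd: "is_modulus \<alpha> \<beta> wd" and rpf: "rpf_data T a wd \<rho> h \<mu>"
    and bounds: "\<And>x. lo * (transfer_op T a ^^ n) (\<lambda>_. 1) x \<le> (transfer_op T a ^^ n) f x"
      "\<And>x. (transfer_op T a ^^ n) f x \<le> hi * (transfer_op T a ^^ n) (\<lambda>_. 1) x"
  shows "lo \<le> (\<integral>x. f x \<partial>conformal_measure h \<mu>)" "(\<integral>x. f x \<partial>conformal_measure h \<mu>) \<le> hi"
proof -
  have h_pos: "0 < h x" for x using rpf by (simp add: rpf_data_def)
  have eigen: "transfer_op T a h x = \<rho> * h x" for x using rpf by (simp add: rpf_data_def)
  have sets: "sets \<mu> = sets borel" and mass: "emeasure \<mu> UNIV = 1"
    and norm: "(\<integral>x. inverse (h x) \<partial>\<mu>) = 1"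
    and inv: "\<And>F. continuous_on UNIV F \<Longrightarrow>
      (\<integral>x. transfer_op T (normalized_potential T a \<rho> h) F x \<partial>\<mu>) = (\<integral>x. F x \<partial>\<mu>)"
    using rpf by (auto simp: rpf_data_def)
  obtain C where "holder_with wd C h" using rpf by (auto simp: rpf_data_def)
  then have h: "continuous_on UNIV h" by (rule continuous_on_of_holder_with[OF wd])
  have h_ne: "h x \<noteq> 0" for x using h_pos[of x] by simp
  \<comment> \<open>In \<open>rpf_data\<close>, \<rho> is a limit of roots; its positivity is read
    off from the eigenvalue equation at one point.\<close>
  have \<rho>: "0 < \<rho>"
  proof -
    fix x
    obtain y where "T y = x" using surj_iterate[of 1 x] by auto
    then have "0 < transfer_op T a h x"
      unfolding transfer_op_def using finite_fibre h_pos by (intro sum_pos) auto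
    then show ?thesis using h_pos[of x] by (simp add: eigen zero_less_mult_iff)
  qed
  define P where "P = transfer_op T (normalized_potential T a \<rho> h)"
  \<comment> \<open>The term \<open>ln (h (T y))\<close> is constant on the fibre, so the normalized
    operator is \<open>transfer_op T a\<close> conjugated by \<open>h\<close> and divided by
    \<rho>.\<close>
  have P: "P F x = transfer_op T a (\<lambda>y. h y * F y) x / (\<rho> * h x)" for F x
  proof -
    have "exp (normalized_potential T a \<rho> h y) * F y = exp (a y) * (h y * F y) / (\<rho> * h x)"
      if "T y = x" for y
      using that h_pos \<rho> by (simp add: normalized_potential_def exp_diff exp_add mult_ac)
    then show ?thesis by (simp add: P_def transfer_op_def sum_divide_distrib)
  qed
  have P_cont: "continuous_on UNIV (P F)" if "continuous_on UNIV F" for F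
  proof -
    have "continuous_on UNIV (\<lambda>x. transfer_op T a (\<lambda>y. h y * F y) x / (\<rho> * h x))"
      using h_ne \<rho>
      by (intro continuous_intros continuous_on_transfer_op[OF cpt r L a] h that) auto
    then show ?thesis by (simp add: P[abs_def])
  qed
  have Pn_cont: "continuous_on UNIV ((P ^^ k) F)" if "continuous_on UNIV F" for F k
    by (induction k) (use that P_cont in auto)
  have Pn_int: "(\<integral>x. (P ^^ k) F x \<partial>\<mu>) = (\<integral>x. F x \<partial>\<mu>)" if "continuous_on UNIV F" for F k
    by (induction k) (use inv[OF Pn_cont[OF that]] in \<open>auto simp: P_def\<close>)
  have Pn: "(P ^^ k) F x = (transfer_op T a ^^ k) (\<lambda>y. h y * F y) x / (\<rho> ^ k * h x)" for k F x
  proof (induction k arbitrary: x)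
    case (Suc k)
    have "(P ^^ Suc k) F x = transfer_op T a (\<lambda>y. (transfer_op T a ^^ k) (\<lambda>y. h y * F y) y / \<rho> ^ k) x / (\<rho> * h x)"
      using h_ne by (simp add: P Suc)
    also have "\<dots> = (transfer_op T a ^^ Suc k) (\<lambda>y. h y * F y) x / (\<rho> ^ Suc k * h x)"
      by (simp add: transfer_op_def sum_divide_distrib[symmetric])
    finally show ?case .
  qed (simp add: h_ne)
  have space: "space \<mu> = UNIV" using sets_eq_imp_space_eq[OF sets] by simp
  interpret finite_measure \<mu> by (rule finite_measureI) (simp add: space mass)
  have meas: "F \<in> borel_measurable \<mu>" if "continuous_on UNIV F" for F :: "'a \<Rightarrow> real"
    using borel_measurable_continuous_onI[OF that] measurable_cong_sets[OF sets refl] by blast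
  have int: "integrable \<mu> F" if "continuous_on UNIV F" for F :: "'a \<Rightarrow> real"
  proof -
    have "bounded (range F)" using compact_continuous_image[OF that cpt] by (rule compact_imp_bounded)
    then obtain b where "\<And>x. norm (F x) \<le> b" unfolding bounded_iff by blast
    then show ?thesis by (intro integrable_const_bound[of _ b] meas that) auto
  qed
  have conf: "(\<integral>x. f x \<partial>conformal_measure h \<mu>) = (\<integral>x. f x / h x \<partial>\<mu>)"
  proof -
    have hi: "continuous_on UNIV (\<lambda>x. inverse (h x))" using h_ne by (intro continuous_intros h) auto
    show ?thesis unfolding conformal_measure_def
      using h_pos by (subst integral_density) (auto intro!: meas f hi simp: less_imp_le divide_inverse mult.commute)
  qed
  have c1: "continuous_on UNIV (\<lambda>x. f x / h x)" "continuous_on UNIV (\<lambda>x. 1 / h x)"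
    using h_ne by (auto intro!: continuous_intros h f)
  \<comment> \<open>Applied to \<open>f / h\<close> and \<open>1 / h\<close>, the iterates of
    \<open>P\<close> give the iterates of \<open>transfer_op T a\<close> on \<open>f\<close> and on
    1 over a common denominator. By invariance their integrals are the conformal integral of
    \<open>f\<close> and 1.\<close>
  have Pf: "(P ^^ n) (\<lambda>x. f x / h x) x = (transfer_op T a ^^ n) f x / (\<rho> ^ n * h x)" for x
    using h_ne by (simp add: Pn)
  have P1: "(P ^^ n) (\<lambda>x. 1 / h x) x = (transfer_op T a ^^ n) (\<lambda>_. 1) x / (\<rho> ^ n * h x)" for x
    using h_ne by (simp add: Pn)
  have one: "(\<integral>x. k * (P ^^ n) (\<lambda>x. 1 / h x) x \<partial>\<mu>) = k" for k
    using norm by (simp add: Pn_int[OF c1(2)] inverse_eq_divide)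
  have pos: "0 < \<rho> ^ n * h x" for x using \<rho> h_pos by simp
  have "(\<integral>x. lo * (P ^^ n) (\<lambda>x. 1 / h x) x \<partial>\<mu>) \<le> (\<integral>x. (P ^^ n) (\<lambda>x. f x / h x) x \<partial>\<mu>)"
    by (intro integral_mono int continuous_intros Pn_cont c1)
      (use bounds(1) pos in \<open>simp add: Pf P1 divide_right_mono less_imp_le\<close>)
  then show "lo \<le> (\<integral>x. f x \<partial>conformal_measure h \<mu>)"
    by (simp only: one Pn_int[OF c1(1)] conf)
  have "(\<integral>x. (P ^^ n) (\<lambda>x. f x / h x) x \<partial>\<mu>) \<le> (\<integral>x. hi * (P ^^ n) (\<lambda>x. 1 / h x) x \<partial>\<mu>)"
    by (intro integral_mono int continuous_intros Pn_cont c1)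
      (use bounds(2) pos in \<open>simp add: Pf P1 divide_right_mono less_imp_le\<close>)
  then show "(\<integral>x. f x \<partial>conformal_measure h \<mu>) \<le> hi"
    by (simp only: one Pn_int[OF c1(1)] conf)
qed

end

section \<open>Choice of the constants and conclusion\<close>

theorem corollary2p12:
  fixes T :: "'a::metric_space \<Rightarrow> 'a"
    and c :: "nat \<Rightarrow> real \<Rightarrow> real"
    and r \<gamma> :: real
    and w wd :: "real \<Rightarrow> real"
  assumes "compact (UNIV :: 'a set)"
    and "diameter (UNIV :: 'a set) = 1"
    and "\<And>n. local_homeomorphism (T ^^ n)"
    and "r > 0"
    and "contraction_family c"
    and "ruelle_expansive c r T"
    and "topologically_mixing T"
    and "setting_I c w \<gamma> wd \<or> setting_II c w \<gamma> wd"
  shows "\<exists>\<kappa>>0. \<exists>ca :: real \<Rightarrow> real.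
           continuous_on {0..} ca \<and> (\<forall>u\<ge>0. 0 < ca u) \<and>
           (\<forall>(a :: 'a \<Rightarrow> real) C\<^sub>a \<rho> h \<mu>.
              holder_with w C\<^sub>a a \<longrightarrow> rpf_data T a wd \<rho> h \<mu> \<longrightarrow>
              (\<forall>f :: 'a \<Rightarrow> real. (\<exists>C. holder_with wd C f) \<longrightarrow>
                 (\<forall>n::nat. n \<ge> 1 \<longrightarrow>
                    sup_norm (\<lambda>x. (transfer_op T a ^^ n) f x / (transfer_op T a ^^ n) (\<lambda>_. 1) x
                                  - (\<integral>y. f y \<partial>conformal_measure h \<mu>))
                    \<le> \<kappa> * exp (\<kappa> * C\<^sub>a) * holder_norm r wd f
                        * (ca (holder_norm r w a) + real n) powr (- \<gamma>))))"
proof -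
  note cpt = assms(1)
  have dist1: "dist x y \<le> 1" for x y :: 'a
    using diameter_bounded_bound[OF compact_imp_bounded[OF cpt], of x y] assms(2) by simp
  \<comment> \<open>Two distinct points exist because the diameter is not 0; they show that a
    Hoelder coefficient is nonnegative.\<close>
  obtain x0 y0 :: 'a where x0y0: "x0 \<noteq> y0"
  proof -
    have False if "\<And>x y :: 'a. x = y"
    proof -
      have "(\<lambda>(x, y). dist x y) = (\<lambda>_ :: 'a \<times> 'a. 0)" using that by (auto simp: fun_eq_iff)
      then have "diameter (UNIV :: 'a set) = 0" by (simp add: diameter_def)
      then show False using assms(2) by simp
    qed
    then show thesis using that by blast
  qed
  have "polynomial_decay c w \<gamma> wd"
    using assms(8) setting_I_decay setting_II_decay by blast
  then obtain \<alpha>1 \<beta>1 \<alpha>2 \<beta>2 L B where \<gamma>: "0 < \<gamma>"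
    and w: "is_modulus \<alpha>1 \<beta>1 w" and wd: "is_modulus \<alpha>2 \<beta>2 wd"
    and L: "0 \<le> L" "\<forall>t\<in>{0..1}. c 1 t \<le> L * t"
    and B: "0 \<le> B" "\<forall>j\<ge>1. \<forall>t\<in>{0..1}. \<forall>u\<in>{0..1}. u \<le> c j t \<longrightarrow>
        w u \<le> B * real j powr - (\<gamma> + 1) \<and> wd u \<le> B * real j powr - \<gamma>"
    unfolding polynomial_decay_def by (elim conjE exE)
  note L = L(1) L(2)[rule_format] and B = B(1) B(2)[rule_format]
  have "local_homeomorphism T" using assms(3)[of 1] by simp
  from fibre_card_bounded[OF cpt this] obtain D
    where D: "\<And>x. finite {y. T y = x}" "\<And>x. card {y. T y = x} \<le> D" by blast
  from uniform_hitting_time[OF cpt dist1 assms(4-7)] obtain N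
    where N: "1 \<le> N" "\<And>x z. \<exists>y. (T ^^ N) y = x \<and> dist y z < r" by blast
  interpret ruelle_system T c r D N
    by unfold_locales (fact dist1 assms(6) D N)+
  define k where "k = nat \<lceil>\<gamma>\<rceil>"
  have k: "\<gamma> \<le> real k" by (simp add: k_def real_nat_ceiling_ge)
  \<comment> \<open>The maximum with \<open>w 1\<close> covers the total oscillation of
    \<open>a\<close>, as all distances are at most 1. Thus \<open>B' * Ca\<close> can be the
    constant \<open>C\<close> of \<open>ruelle_potential\<close>.\<close>
  define B' where "B' = max B (w 1)"
  have B': "0 \<le> B'" "B \<le> B'" "w 1 \<le> B'" using B by (auto simp: B'_def)
  define H where "H = max 1 (2 / wd (min r 1))"
  have H: "1 \<le> H" by (simp add: H_def)
  \<comment> \<open>\<open>M0\<close> times the norm of \<open>f\<close> will bound both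
    \<open>f\<close> and, up to the factor \<open>j powr - \<gamma>\<close>, its variation over
    distances at most \<open>c j t\<close>.\<close>
  define M0 where "M0 = max 1 (H * B)"
  have M0: "1 \<le> M0" "H * B \<le> M0" by (auto simp: M0_def)
  define p where "p = real D ^ (2 * N)"
  have p: "0 < p" using D_pos by (simp add: p_def)
  \<comment> \<open>\<open>\<sigma> * Ca\<close> is the exponent in \<open>E\<close> for
    \<open>C = B' * Ca\<close>. \<open>\<kappa>2\<close> adds up the exponents from
    \<open>exp (4 * C / \<gamma>)\<close>, \<open>E\<close> and \<open>E powr \<gamma>\<close>;
    \<open>\<kappa>1\<close> collects the factors free of \<open>Ca\<close>. None of these depends
    on \<open>a\<close> or \<open>f\<close>.\<close>
  define \<sigma> where "\<sigma> = B' * (2 * N + 5 * (1 + 1 / \<gamma>))"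
  define \<kappa>1 where "\<kappa>1 = 4 * M0 * p * (4 * real k * (real N + 1) * p) powr \<gamma> * 2 powr \<gamma>"
  define \<kappa>2 where "\<kappa>2 = 4 * B' / \<gamma> + \<sigma> + \<gamma> * \<sigma>"
  define \<kappa> where "\<kappa> = max 1 (max \<kappa>1 \<kappa>2)"
  have \<kappa>: "0 < \<kappa>" "\<kappa>1 \<le> \<kappa>" "\<kappa>2 \<le> \<kappa>" by (auto simp: \<kappa>_def)
  have "sup_norm (\<lambda>x. (transfer_op T a ^^ n) f x / (transfer_op T a ^^ n) (\<lambda>_. 1) x
          - (\<integral>y. f y \<partial>conformal_measure h \<mu>))
        \<le> \<kappa> * exp (\<kappa> * Ca) * holder_norm r wd f * (1 + real n) powr (- \<gamma>)"
    if a: "holder_with w Ca a" and rpf: "rpf_data T a wd \<rho> h \<mu>"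
      and f: "holder_with wd C f" and n: "1 \<le> n" for a f :: "'a \<Rightarrow> real" and Ca \<rho> h \<mu> C n
  proof -
    have aC: "\<bar>a x - a y\<bar> \<le> Ca * w (dist x y)" for x y using a by (simp add: holder_with_def)
    have Ca: "0 \<le> Ca"
    proof -
      have "0 < w (dist x0 y0)" using x0y0 dist1 by (intro is_modulus_props(2)[OF w]) auto
      moreover have "0 \<le> Ca * w (dist x0 y0)" using aC[of x0 y0] by linarith
      ultimately show ?thesis by (simp add: zero_le_mult_iff)
    qed
    interpret ruelle_potential T c r D N a "B' * Ca" \<gamma>
    proof unfold_locales
      fix x y :: 'a
      have "Ca * w (dist x y) \<le> Ca * B'"
        using is_modulus_props(3)[OF w, of "dist x y" 1] dist1[of x y] B' Ca
        by (intro mult_left_mono) auto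
      then show "\<bar>a x - a y\<bar> \<le> B' * Ca" using aC[of x y] by (simp add: mult.commute)
    next
      fix j :: nat and t :: real and x y :: 'a
      assume j: "1 \<le> j" "0 \<le> t" "t \<le> 1" "dist x y \<le> c j t"
      have "w (dist x y) \<le> B * real j powr - (\<gamma> + 1)" using B(2)[of j t "dist x y"] j dist1 by simp
      also have "\<dots> \<le> B' * real j powr - (\<gamma> + 1)" using B' by (intro mult_right_mono) auto
      finally have "Ca * w (dist x y) \<le> Ca * (B' * real j powr - (\<gamma> + 1))" using Ca by (rule mult_left_mono)
      then show "\<bar>a x - a y\<bar> \<le> B' * Ca * real j powr - (\<gamma> + 1)" using aC[of x y] by (simp add: mult_ac)
    qed (use \<gamma> B' Ca in auto)
    define F where "F = holder_norm r wd f"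
    note fb = holder_norm_bounds[OF dist1 assms(4) wd f, folded F_def H_def]
    have F: "0 \<le> F" using fb(1)[of x0] by linarith
    define E where "E = p * exp (\<sigma> * Ca)"
    define v where "v = 4 * (M0 * F) * exp (4 * (B' * Ca) / \<gamma>) * E * (4 * real k * (real N + 1) * E) powr \<gamma>
      * real n powr - \<gamma>"
    have osc: "Q f n x - Q f n y \<le> v" for x y
      unfolding v_def
    proof (rule osc_decay[OF _ _ k n])
      show "\<bar>f z\<bar> \<le> M0 * F" for z
        using fb(1)[of z] mult_right_mono[OF M0(1) F] by simp
      show "\<bar>f z - f z'\<bar> \<le> M0 * F * real j powr - \<gamma>"
        if "1 \<le> j" "0 \<le> t" "t \<le> 1" "dist z z' \<le> c j t" for j t z z'
      proof -
        have "wd (dist z z') \<le> B * real j powr - \<gamma>" using B(2)[of j t "dist z z'"] that dist1 by simp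
        then have "H * F * wd (dist z z') \<le> H * F * (B * real j powr - \<gamma>)"
          using H F by (intro mult_left_mono) auto
        also have "\<dots> = (H * B) * (F * real j powr - \<gamma>)" by (simp add: mult_ac)
        also have "\<dots> \<le> M0 * (F * real j powr - \<gamma>)" using M0 F by (intro mult_right_mono) auto
        finally show ?thesis using fb(2)[of z z'] by (simp add: mult_ac)
      qed
      have "2 * N * (B' * Ca) + 5 * E0 = \<sigma> * Ca"
        by (simp add: E0_def \<sigma>_def algebra_simps)
      then show "E = real D ^ (2 * N) * exp (2 * N * (B' * Ca) + 5 * E0)"
        by (simp add: E_def p_def)
    qed
    have v: "v \<le> \<kappa> * exp (\<kappa> * Ca) * F * (1 + real n) powr - \<gamma>"
    proof -
      have "(4 * real k * (real N + 1) * E) powr \<gamma> = (4 * real k * (real N + 1) * p) powr \<gamma> * exp (\<gamma> * \<sigma> * Ca)"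
        using p by (simp add: E_def powr_mult exp_powr_real mult_ac)
      then have "v = 4 * M0 * p * (4 * real k * (real N + 1) * p) powr \<gamma>
          * (exp (4 * (B' * Ca) / \<gamma>) * exp (\<sigma> * Ca) * exp (\<gamma> * \<sigma> * Ca)) * F * real n powr - \<gamma>"
        by (simp add: v_def E_def mult_ac)
      also have "exp (4 * (B' * Ca) / \<gamma>) * exp (\<sigma> * Ca) * exp (\<gamma> * \<sigma> * Ca) = exp (\<kappa>2 * Ca)"
        by (simp add: \<kappa>2_def exp_add[symmetric] algebra_simps)
      also have "4 * M0 * p * (4 * real k * (real N + 1) * p) powr \<gamma> * exp (\<kappa>2 * Ca) * F * real n powr - \<gamma>
        \<le> 4 * M0 * p * (4 * real k * (real N + 1) * p) powr \<gamma> * exp (\<kappa>2 * Ca) * F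
          * (2 powr \<gamma> * (1 + real n) powr - \<gamma>)"
      proof (rule mult_left_mono)
        \<comment> \<open>For \<open>n \<ge> 1\<close>, \<open>1 + n \<le> 2 * n\<close>. This
          allows the constant value 1 for \<open>ca\<close>, at the cost of the factor
          \<open>2 powr \<gamma>\<close> in \<open>\<kappa>1\<close>.\<close>
        have "(2 * real n) powr - \<gamma> \<le> (1 + real n) powr - \<gamma>"
          using n \<gamma> by (intro powr_mono2') auto
        then have "2 powr \<gamma> * (2 * real n) powr - \<gamma> \<le> 2 powr \<gamma> * (1 + real n) powr - \<gamma>"
          by (intro mult_left_mono) auto
        moreover have "2 powr \<gamma> * (2 * real n) powr - \<gamma> = real n powr - \<gamma>"
          by (simp add: powr_mult powr_minus)
        ultimately show "real n powr - \<gamma> \<le> 2 powr \<gamma> * (1 + real n) powr - \<gamma>"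
          by simp
      qed (use M0 p F in auto)
      also have "\<dots> = \<kappa>1 * exp (\<kappa>2 * Ca) * (F * (1 + real n) powr - \<gamma>)"
        by (simp add: \<kappa>1_def mult_ac)
      also have "\<dots> \<le> \<kappa> * exp (\<kappa> * Ca) * (F * (1 + real n) powr - \<gamma>)"
        using \<kappa> Ca F by (intro mult_right_mono mult_mono) (auto intro: mult_right_mono)
      finally show ?thesis by (simp add: mult_ac)
    qed
    have af: "continuous_on UNIV a" "continuous_on UNIV f"
      using continuous_on_of_holder_with a f w wd by blast+
    have Lf: "(transfer_op T a ^^ n) f y = Q f n y * (transfer_op T a ^^ n) (\<lambda>_. 1) y" for y
      using g_pos[of n y] by (simp add: Q_def g_def)
    have "\<bar>Q f n x - (\<integral>y. f y \<partial>conformal_measure h \<mu>)\<bar> \<le> v" for x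
    proof -
      have g0: "0 \<le> (transfer_op T a ^^ n) (\<lambda>_. 1) y" for y using g_pos[of n y] by (simp add: g_def)
      \<comment> \<open>Every value \<open>Q f n y\<close> is within \<open>v\<close> of
        \<open>Q f n x\<close>; the integral is an average of such values and inherits the
        bounds.\<close>
      have "Q f n x - v \<le> (\<integral>y. f y \<partial>conformal_measure h \<mu>)"
      proof (rule conformal_average_bounds(1)[OF cpt assms(4) L af wd rpf])
        show "(Q f n x - v) * (transfer_op T a ^^ n) (\<lambda>_. 1) y \<le> (transfer_op T a ^^ n) f y" for y
          unfolding Lf using osc[of x y] g0 by (intro mult_right_mono) auto
        show "(transfer_op T a ^^ n) f y \<le> (Q f n x + v) * (transfer_op T a ^^ n) (\<lambda>_. 1) y" for y
          unfolding Lf using osc[of y x] g0 by (intro mult_right_mono) auto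
      qed
      moreover have "(\<integral>y. f y \<partial>conformal_measure h \<mu>) \<le> Q f n x + v"
      proof (rule conformal_average_bounds(2)[OF cpt assms(4) L af wd rpf])
        show "(Q f n x - v) * (transfer_op T a ^^ n) (\<lambda>_. 1) y \<le> (transfer_op T a ^^ n) f y" for y
          unfolding Lf using osc[of x y] g0 by (intro mult_right_mono) auto
        show "(transfer_op T a ^^ n) f y \<le> (Q f n x + v) * (transfer_op T a ^^ n) (\<lambda>_. 1) y" for y
          unfolding Lf using osc[of y x] g0 by (intro mult_right_mono) auto
      qed
      ultimately show ?thesis by linarith
    qed
    then have "sup_norm (\<lambda>x. Q f n x - (\<integral>y. f y \<partial>conformal_measure h \<mu>)) \<le> v"
      unfolding sup_norm_def by (intro cSUP_least) auto
    then show ?thesis using v by (simp add: Q_def g_def F_def)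
  qed
  then show ?thesis
    by (intro exI[of _ \<kappa>] conjI \<kappa>(1) exI[of _ "\<lambda>_. 1"]) auto
qed

end
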